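(* Let $X$ be a uniformly convex complex Banach space, $Y$ an arbitrary complex Banach space, and $N\in\mathbb{N}$. Then for every $\varepsilon>0$ there is $\eta(\varepsilon)>0$ such that whenever $P\in\mathcal{P}^N(X;Y)$ with $\|P\|_v=1$ and $x\in B_X$ satisfy $$(1-\|x\|^2)\|P(x)\|\geq \|P\|_v-\eta(\varepsilon),$$ there are $Q\in\mathcal{P}^N(X;Y)$ and $y\in B_X$ such that $$\|Q\|_v=(1-\|y\|^2)\|Q(y)\|,\qquad d\big(y,\operatorname{span}_{\mathbb{C}}(x)\big)\leq\varepsilon,\qquad \|P-Q\|_\infty\leq\varepsilon.$$
   Context: All Banach spaces are complex; $B_X$ is the open unit ball of $X$. $\mathcal{P}^N(X;Y)$ is the space of (continuous) polynomials from $X$ to $Y$ of degree at most $N$, i.e. maps $P=\sum_{k=0}^N P_k$ with $P_k$ a continuous $k$-homogeneous polynomial ($P_k(x)=A_k(x,\dots,x)$ for a continuous symmetric $k$-linear map $A_k$; $P_0$ constant). $\|P\|_v=\sup_{x\in B_X}(1-\|x\|^2)\|P(x)\|$ and $\|P\|_\infty=\sup_{x\in B_X}\|P(x)\|$. $d(y,Z)=\inf_{z\in Z}\|y-z\|$ and $\operatorname{span}_{\mathbb{C}}(x)=\{\lambda x:\lambda\in\mathbb{C}\}$. *)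

theory Defs
  imports "HOL-Analysis.Analysis"
begin

class complex_normed_vector = real_normed_vector +
  fixes scaleC :: "complex \<Rightarrow> 'a \<Rightarrow> 'a"  (infixr "*\<^sub>C" 75)
  assumes scaleC_add_right: "c *\<^sub>C (x + y) = c *\<^sub>C x + c *\<^sub>C y"
    and scaleC_add_left: "(c + d) *\<^sub>C x = c *\<^sub>C x + d *\<^sub>C x"
    and scaleC_scaleC: "c *\<^sub>C d *\<^sub>C x = (c * d) *\<^sub>C x"
    and scaleC_of_real: "complex_of_real r *\<^sub>C x = r *\<^sub>R x"
    and norm_scaleC: "norm (c *\<^sub>C x) = cmod c * norm x"

class complex_banach = complex_normed_vector + complete_space

subclass (in complex_banach) banach ..

instantiation complex :: complex_banach
begin

definition scaleC_complex :: "complex \<Rightarrow> complex \<Rightarrow> complex"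
  where "scaleC_complex = (*)"

instance
  by standard
    (auto simp: scaleC_complex_def algebra_simps norm_mult scaleR_conv_of_real)

end

lemma vector_space_scaleC:
  "vector_space (scaleC :: complex \<Rightarrow> 'a::complex_normed_vector \<Rightarrow> 'a)"
  using scaleC_of_real[of 1]
  by unfold_locales (auto simp: scaleC_add_right scaleC_add_left scaleC_scaleC)

definition uniformly_convex :: "'a::real_normed_vector itself \<Rightarrow> bool"
  where "uniformly_convex _ \<longleftrightarrow>
    (\<forall>\<epsilon>>0. \<exists>\<delta>>0. \<forall>x y :: 'a.
        norm x = 1 \<and> norm y = 1 \<and> norm (x - y) \<ge> \<epsilon> \<longrightarrow>
        norm ((x + y) /\<^sub>R 2) \<le> 1 - \<delta>)"

text \<open>
  The power $X^k$ is rendered as the set of extensional functions on \<open>{..<k}\<close>, which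
  is the carrier of the product topology below; only the values of \<open>A\<close> on it matter.
  For \<open>k = 0\<close> it is a singleton.
\<close>

definition cont_sym_multilinear ::
    "nat \<Rightarrow> ((nat \<Rightarrow> 'a::complex_normed_vector) \<Rightarrow> 'b::complex_normed_vector) \<Rightarrow> bool"
  where "cont_sym_multilinear k A \<longleftrightarrow>
    (\<forall>x \<in> {..<k} \<rightarrow>\<^sub>E UNIV. \<forall>i<k.
        Vector_Spaces.linear scaleC scaleC (\<lambda>z. A (x(i := z)))) \<and>
    (\<forall>x \<in> {..<k} \<rightarrow>\<^sub>E UNIV. \<forall>\<pi>. \<pi> permutes {..<k} \<longrightarrow> A (x \<circ> \<pi>) = A x) \<and>
    continuous_map (product_topology (\<lambda>_. euclidean) {..<k}) euclidean A"

definition homogeneous_poly ::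
    "nat \<Rightarrow> ('a::complex_normed_vector \<Rightarrow> 'b::complex_normed_vector) \<Rightarrow> bool"
  where "homogeneous_poly k P \<longleftrightarrow>
    (\<exists>A. cont_sym_multilinear k A \<and> (\<forall>x. P x = A (\<lambda>i\<in>{..<k}. x)))"

definition polys_upto ::
    "nat \<Rightarrow> ('a::complex_normed_vector \<Rightarrow> 'b::complex_normed_vector) set"
  where "polys_upto N =
    {P. \<exists>p. (\<forall>k\<le>N. homogeneous_poly k (p k)) \<and> P = (\<lambda>x. \<Sum>k\<le>N. p k x)}"

text \<open>
  Both suprema are taken in the reals; they are the intended ones because continuous
  polynomials are bounded on the open unit ball.
\<close>

definition norm_v :: "('a::real_normed_vector \<Rightarrow> 'b::real_normed_vector) \<Rightarrow> real"
  where "norm_v P = (SUP x\<in>ball 0 1. (1 - (norm x)\<^sup>2) * norm (P x))"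

definition norm_inf :: "('a::real_normed_vector \<Rightarrow> 'b::real_normed_vector) \<Rightarrow> real"
  where "norm_inf P = (SUP x\<in>ball 0 1. norm (P x))"

end

theory Submission
  imports Defs "HOL-Complex_Analysis.Conformal_Mappings"
begin

text \<open>
  Write \<open>f\<^sub>P z = (1 - \<parallel>z\<parallel>\<^sup>2) \<parallel>P z\<parallel>\<close>. Along a complex line through \<open>0\<close> the maximum of \<open>\<parallel>P\<parallel>\<close> on circles
  of radius \<open>r\<close>, divided by \<open>r\<^sup>N\<close>, does not increase (maximum modulus), so an almost maximal point of \<open>f\<^sub>P\<close>
  may be moved inside its line to radius at most \<open>\<surd>(N / (N + 2))\<close>. For \<open>x\<close> in that smaller ball, with
  norming functional \<open>x*\<close>, the polynomial \<open>\<phi> = (a + b x*)\<^sup>N\<close>, \<open>a\<close> and \<open>b\<close> chosen so that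
  \<open>(1 - r\<^sup>2) (a + b r)\<^sup>N\<close> is maximal at \<open>r = \<parallel>x\<parallel>\<close>, makes \<open>f\<^sub>\<phi>\<close> peak at \<open>x\<close>; by uniform convexity, almost
  maximal points of \<open>f\<^sub>\<phi>\<close> are close to the circle \<open>{\<beta> x. \<bar>\<beta>\<bar> = 1}\<close>, uniformly in \<open>x\<close>. Repeatedly adding
  small multiples \<open>c\<^sub>n \<phi>\<^sub>n u\<^sub>n\<close> to \<open>P\<close> therefore produces almost maximal points \<open>\<beta>\<^sub>n v\<^sub>n\<close> with \<open>v\<^sub>n\<close> Cauchy and
  \<open>\<bar>\<beta>\<^sub>n\<bar> = 1\<close>, and a subsequence converges to a maximal point for the limit polynomial.
\<close>

subsection \<open>Complex scalar multiplication\<close>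

abbreviation clin :: "('a::complex_normed_vector \<Rightarrow> 'b::complex_normed_vector) \<Rightarrow> bool"
  where "clin \<equiv> Vector_Spaces.linear scaleC scaleC"

lemma clin_iff:
  "clin f \<longleftrightarrow> (\<forall>x y. f (x + y) = f x + f y) \<and> (\<forall>c x. f (c *\<^sub>C x) = c *\<^sub>C f x)"
  by (simp add: Vector_Spaces.linear_iff vector_space_scaleC)

lemma scaleC_one [simp]: "1 *\<^sub>C (x::'a::complex_normed_vector) = x"
  using scaleC_of_real[of 1 x] by simp

lemma scaleC_zero_left [simp]: "0 *\<^sub>C (x::'a::complex_normed_vector) = 0"
  using scaleC_of_real[of 0 x] by simp

lemma scaleC_zero_right [simp]: "c *\<^sub>C (0::'a::complex_normed_vector) = 0"
  using scaleC_add_right[of c 0 "0::'a"] by simp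

lemma scaleC_minus_left: "(- c) *\<^sub>C (x::'a::complex_normed_vector) = - (c *\<^sub>C x)"
  using scaleC_add_left[of "-c" c x] by (simp add: eq_neg_iff_add_eq_0)

lemma scaleC_minus_right: "c *\<^sub>C (- x) = - (c *\<^sub>C (x::'a::complex_normed_vector))"
  using scaleC_add_right[of c "-x" x] by (simp add: eq_neg_iff_add_eq_0)

lemma scaleC_diff_right: "c *\<^sub>C (x - y) = c *\<^sub>C x - c *\<^sub>C (y::'a::complex_normed_vector)"
  using scaleC_add_right[of c x "-y"] by (simp add: scaleC_minus_right)

lemma scaleC_sum_left: "(\<Sum>i\<in>I. f i) *\<^sub>C (x::'a::complex_normed_vector) = (\<Sum>i\<in>I. f i *\<^sub>C x)"
  by (induction I rule: infinite_finite_induct) (simp_all add: scaleC_add_left)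

lemma scaleC_scaleR: "c *\<^sub>C r *\<^sub>R (x::'a::complex_normed_vector) = r *\<^sub>R c *\<^sub>C x"
  by (metis scaleC_of_real scaleC_scaleC mult.commute)

lemma bounded_bilinear_scaleC:
  "bounded_bilinear (scaleC :: complex \<Rightarrow> 'a \<Rightarrow> 'a::complex_normed_vector)"
proof
  fix r :: real and a :: complex and b :: 'a
  show "(r *\<^sub>R a) *\<^sub>C b = r *\<^sub>R a *\<^sub>C b"
    by (metis scaleC_of_real scaleC_scaleC scaleR_conv_of_real)
  show "\<exists>K. \<forall>a b. norm (a *\<^sub>C (b::'a)) \<le> norm a * norm b * K"
    by (intro exI[of _ 1]) (simp add: norm_scaleC)
qed (simp_all add: scaleC_add_left scaleC_add_right scaleC_scaleR)

subsection \<open>The Hahn--Banach theorem\<close>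

definition sublinear :: "('a::real_vector \<Rightarrow> real) \<Rightarrow> bool"
  where "sublinear q \<longleftrightarrow> (\<forall>x y. q (x + y) \<le> q x + q y) \<and> (\<forall>r x. r \<ge> 0 \<longrightarrow> q (r *\<^sub>R x) = r * q x)"

text \<open>The reverse inequality comes from the same hypothesis, applied to
  \<open>inverse r\<close> and \<open>r *\<^sub>R x\<close>.\<close>

lemma sublinearI:
  assumes "\<And>x y. q (x + y) \<le> q x + q y" "q 0 = 0" "\<And>r x. r > 0 \<Longrightarrow> q (r *\<^sub>R x) \<le> r * q x"
  shows "sublinear q"
proof -
  have "q (r *\<^sub>R x) = r * q x" if "r \<ge> 0" for r x
  proof (cases "r = 0")
    case False
    with that have "r > 0" by simp
    moreover have "q x \<le> inverse r * q (r *\<^sub>R x)"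
      using assms(3)[of "inverse r" "r *\<^sub>R x"] \<open>r > 0\<close> by simp
    ultimately show ?thesis using assms(3)[of r x] by (simp add: field_simps)
  qed (simp add: assms)
  then show ?thesis using assms(1) by (simp add: sublinear_def)
qed

lemma sublinear_zero: "sublinear q \<Longrightarrow> q 0 = 0"
  unfolding sublinear_def by (metis mult_zero_left order_refl scaleR_zero_left)

lemma sublinear_lower:
  assumes "sublinear q" shows "- q (- x) \<le> q x"
proof -
  have "q (x + - x) \<le> q x + q (- x)" using assms unfolding sublinear_def by blast
  then show ?thesis using sublinear_zero[OF assms] by simp
qed

text \<open>
  For a minimal \<open>q\<close> these bounds force \<open>q (- y) = - q y\<close>, hence linearity.
\<close>

lemma sublinear_INF_ray:
  fixes q :: "'a::real_vector \<Rightarrow> real" and y :: 'a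
  assumes q: "sublinear q"
  defines "q' \<equiv> \<lambda>x. INF t\<in>{0..}. q (x + t *\<^sub>R y) - t * q y"
  shows "sublinear q'" "\<And>x. q' x \<le> q x" "q' (- y) \<le> - q y"
proof -
  have bdd: "bdd_below ((\<lambda>t. q (x + t *\<^sub>R y) - t * q y) ` {0..})" for x
  proof (rule bdd_belowI2)
    fix t :: real assume "t \<in> {0..}"
    then have "q (t *\<^sub>R y) = t * q y" using q by (simp add: sublinear_def)
    moreover have "q ((x + t *\<^sub>R y) + - x) \<le> q (x + t *\<^sub>R y) + q (- x)"
      using q unfolding sublinear_def by blast
    ultimately show "- q (- x) \<le> q (x + t *\<^sub>R y) - t * q y" by simp
  qed
  have le: "q' x \<le> q (x + t *\<^sub>R y) - t * q y" if "t \<ge> 0" for x t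
    unfolding q'_def using bdd that by (intro cINF_lower) auto
  have ge: "l \<le> q' x" if "\<And>t. t \<ge> 0 \<Longrightarrow> l \<le> q (x + t *\<^sub>R y) - t * q y" for x l
    unfolding q'_def using that by (intro cINF_greatest) auto
  show le_q: "q' x \<le> q x" for x using le[of 0 x] by simp
  show "q' (- y) \<le> - q y" using le[of 1 "- y"] sublinear_zero[OF q] by simp
  show "sublinear q'"
  proof (rule sublinearI)
    fix x z
    \<comment> \<open>Parameters s for x and t for z add up to the admissible parameter
      \<open>s + t\<close> for \<open>x + z\<close>; the two infima are then taken one after the
      other.\<close>
    have "q' (x + z) - (q (z + t *\<^sub>R y) - t * q y) \<le> q' x" if t: "t \<ge> 0" for t
    proof (rule ge)
      fix s :: real assume s: "s \<ge> 0"
      have "q ((x + s *\<^sub>R y) + (z + t *\<^sub>R y)) \<le> q (x + s *\<^sub>R y) + q (z + t *\<^sub>R y)"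
        using q unfolding sublinear_def by blast
      moreover have "q' (x + z) \<le> q ((x + z) + (s + t) *\<^sub>R y) - (s + t) * q y"
        using s t by (intro le) simp
      ultimately show "q' (x + z) - (q (z + t *\<^sub>R y) - t * q y) \<le> q (x + s *\<^sub>R y) - s * q y"
        by (simp add: algebra_simps)
    qed
    then have "q' (x + z) - q' x \<le> q' z"
      by (intro ge) (simp add: algebra_simps)
    then show "q' (x + z) \<le> q' x + q' z" by simp
  next
    have "0 \<le> q' 0"
      by (rule ge) (use q in \<open>simp add: sublinear_def\<close>)
    with le_q[of 0] sublinear_zero[OF q] show "q' 0 = 0" by simp
  next
    fix r :: real and x assume r: "r > 0"
    have "q' (r *\<^sub>R x) / r \<le> q' x"
    proof (rule ge)
      fix t :: real assume t: "t \<ge> 0"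
      have "q' (r *\<^sub>R x) \<le> q (r *\<^sub>R x + (r * t) *\<^sub>R y) - (r * t) * q y"
        using r t by (intro le) simp
      also have "q (r *\<^sub>R x + (r * t) *\<^sub>R y) = r * q (x + t *\<^sub>R y)"
      proof -
        have "r *\<^sub>R x + (r * t) *\<^sub>R y = r *\<^sub>R (x + t *\<^sub>R y)" by (simp add: scaleR_add_right)
        then show ?thesis using q r unfolding sublinear_def by (metis less_imp_le)
      qed
      finally show "q' (r *\<^sub>R x) / r \<le> q (x + t *\<^sub>R y) - t * q y"
        using r by (simp add: field_simps)
    qed
    then show "q' (r *\<^sub>R x) \<le> r * q' x" using r by (simp add: field_simps)
  qed
qed

text \<open>Zorn's lemma for the reversed order. A chain has its pointwise infimum as lower bound,
  which is finite because \<open>- p (- x)\<close> bounds every member from below at x.\<close>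

lemma minimal_sublinear_exists:
  fixes p :: "'a::real_vector \<Rightarrow> real"
  assumes p: "sublinear p"
  shows "\<exists>m. sublinear m \<and> m \<le> p \<and> (\<forall>q. sublinear q \<longrightarrow> q \<le> m \<longrightarrow> q = m)"
proof -
  define S where "S = {q. sublinear q \<and> q \<le> p}"
  have "\<exists>m\<in>S. \<forall>a\<in>S. m \<ge> a \<longrightarrow> a = m"
  proof (rule predicate_Zorn)
    show "partial_order_on S (relation_of (\<ge>) S)"
      by (rule partial_order_on_relation_ofI) auto
    fix C assume C: "C \<in> Chains (relation_of (\<ge>) S)"
    then have CS: "q \<in> S" if "q \<in> C" for q
      using that by (auto simp: Chains_def relation_of_def)
    have tot: "q \<le> q' \<or> q' \<le> q" if "q \<in> C" "q' \<in> C" for q q'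
      using C that by (auto simp: Chains_def relation_of_def)
    show "\<exists>u\<in>S. \<forall>a\<in>C. a \<ge> u"
    proof (cases "C = {}")
      case True then show ?thesis using p by (auto simp: S_def)
    next
      case False
      define u where "u = (\<lambda>x. INF q\<in>C. q x)"
      have bdd: "bdd_below ((\<lambda>q. q x) ` C)" for x
      proof (rule bdd_belowI2)
        fix q assume "q \<in> C"
        then have "sublinear q" "q (- x) \<le> p (- x)" using CS by (auto simp: S_def le_fun_def)
        with sublinear_lower[of q x] show "- p (- x) \<le> q x" by simp
      qed
      have le: "u x \<le> q x" if "q \<in> C" for q x
        unfolding u_def using bdd that by (intro cINF_lower) auto
      have ge: "l \<le> u x" if "\<And>q. q \<in> C \<Longrightarrow> l \<le> q x" for l x
        unfolding u_def using that False by (intro cINF_greatest) auto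
      have sub: "sublinear q" if "q \<in> C" for q using CS that by (auto simp: S_def)
      have "sublinear u"
      proof (rule sublinearI)
        fix x y
        have "u (x + y) - q y \<le> u x" if q: "q \<in> C" for q
        proof (rule ge)
          fix q' assume q': "q' \<in> C"
          \<comment> \<open>The smaller of the two chain members lies below both, so its own
            subadditivity suffices.\<close>
          obtain q0 where q0: "q0 \<in> C" "q0 \<le> q" "q0 \<le> q'" using tot[OF q q'] q q' by auto
          have "u (x + y) \<le> q0 x + q0 y"
            using le[OF q0(1), of "x + y"] sub[OF q0(1)] unfolding sublinear_def by (meson order_trans)
          also have "\<dots> \<le> q' x + q y" using q0 by (intro add_mono) (auto simp: le_fun_def)
          finally show "u (x + y) - q y \<le> q' x" by simp
        qed
        then have "u (x + y) - u x \<le> u y" by (intro ge) (simp add: algebra_simps)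
        then show "u (x + y) \<le> u x + u y" by simp
      next
        show "u 0 = 0"
          using False sub by (simp add: u_def sublinear_zero)
      next
        fix r :: real and x assume r: "r > 0"
        have "u (r *\<^sub>R x) / r \<le> u x"
        proof (rule ge)
          fix q assume q: "q \<in> C"
          have "u (r *\<^sub>R x) \<le> r * q x"
            using le[OF q, of "r *\<^sub>R x"] sub[OF q] r by (simp add: sublinear_def)
          then show "u (r *\<^sub>R x) / r \<le> q x" using r by (simp add: field_simps)
        qed
        then show "u (r *\<^sub>R x) \<le> r * u x" using r by (simp add: field_simps)
      qed
      moreover have "u \<le> p"
      proof -
        obtain q where "q \<in> C" using False by blast
        then have "q \<in> S" "u \<le> q" using CS le by (auto simp: le_fun_def)
        then show ?thesis by (auto simp: S_def)
      qed
      ultimately show ?thesis using le by (auto simp: S_def le_fun_def)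
    qed
  qed
  then obtain m where "m \<in> S" and m: "\<And>a. a \<in> S \<Longrightarrow> a \<le> m \<Longrightarrow> a = m" by blast
  then have "sublinear m" "m \<le> p" by (auto simp: S_def)
  moreover have "q = m" if "sublinear q" "q \<le> m" for q
    using m[of q] that \<open>m \<le> p\<close> by (auto simp: S_def)
  ultimately show ?thesis by blast
qed

text \<open>By minimality the infimum along a ray cannot fall below \<open>m\<close>, which makes
  \<open>m\<close> odd; for an odd function, subadditivity at the negated arguments is
  superadditivity.\<close>

lemma minimal_sublinear_linear:
  fixes m :: "'a::real_vector \<Rightarrow> real"
  assumes m: "sublinear m" and min: "\<And>q. sublinear q \<Longrightarrow> q \<le> m \<Longrightarrow> q = m"
  shows "linear m"
proof -
  have neg: "m (- y) = - m y" for y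
  proof -
    have eq: "(\<lambda>x. INF t\<in>{0..}. m (x + t *\<^sub>R y) - t * m y) = m"
      by (intro min) (auto simp: le_fun_def sublinear_INF_ray[OF m])
    have "m (- y) \<le> - m y" using sublinear_INF_ray(3)[OF m, of y] unfolding fun_cong[OF eq] .
    with sublinear_lower[OF m, of y] show ?thesis by linarith
  qed
  show ?thesis
  proof (rule linearI)
    fix x y
    have "m (x + y) \<le> m x + m y" "m (- x + - y) \<le> m (- x) + m (- y)"
      using m unfolding sublinear_def by blast+
    then show "m (x + y) = m x + m y" using neg[of "x + y"] by (simp add: neg)
  next
    fix r x
    have *: "m (s *\<^sub>R x) = s * m x" if "s \<ge> 0" for s using m that by (simp add: sublinear_def)
    show "m (r *\<^sub>R x) = r *\<^sub>R m x"
      using *[of r] *[of "- r"] neg[of "r *\<^sub>R x"] by (cases "r \<ge> 0") auto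
  qed
qed

text \<open>Zorn's lemma starts from the norm already lowered along the ray of \<open>x0\<close>:
  whatever lies below it satisfies \<open>m (- x0) \<le> - norm x0\<close>, and so the norm is
  attained at \<open>x0\<close>.\<close>

lemma Hahn_Banach_real:
  fixes x0 :: "'a::real_normed_vector"
  shows "\<exists>f :: 'a \<Rightarrow> real. linear f \<and> (\<forall>x. f x \<le> norm x) \<and> f x0 = norm x0"
proof -
  have n: "sublinear (norm :: 'a \<Rightarrow> real)"
    by (rule sublinearI) (auto simp: norm_triangle_ineq)
  define q where "q x = (INF t\<in>{0..}. norm (x + t *\<^sub>R x0) - t * norm x0)" for x
  note q = sublinear_INF_ray[OF n, where y = x0, folded q_def]
  obtain m where m: "sublinear m" "m \<le> q" "\<And>q. sublinear q \<Longrightarrow> q \<le> m \<Longrightarrow> q = m"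
    using minimal_sublinear_exists[OF q(1)] by blast
  have lin: "linear m" using minimal_sublinear_linear m(1,3) by blast
  have le: "m x \<le> norm x" for x using m(2) q(2)[of x] by (auto simp: le_fun_def intro: order_trans)
  have "m (- x0) \<le> - norm x0" using m(2) q(3) by (auto simp: le_fun_def intro: order_trans)
  then have "m x0 = norm x0" using le[of x0] linear_neg[OF lin, of x0] by linarith
  with lin le show ?thesis by blast
qed

text \<open>A complex functional is determined by its real part \<open>u\<close>: the imaginary part
  at x must be \<open>- u (\<i> *\<^sub>C x)\<close>.\<close>

lemma Hahn_Banach_complex:
  fixes x0 :: "'a::complex_normed_vector"
  shows "\<exists>f :: 'a \<Rightarrow> complex. clin f \<and> (\<forall>x. cmod (f x) \<le> norm x) \<and> f x0 = of_real (norm x0)"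
proof -
  obtain u :: "'a \<Rightarrow> real" where u: "linear u" "\<And>x. u x \<le> norm x" "u x0 = norm x0"
    using Hahn_Banach_real[of x0] by blast
  define f where "f x = Complex (u x) (- u (\<i> *\<^sub>C x))" for x
  have add: "f (x + y) = f x + f y" for x y
    by (simp add: f_def complex_eq_iff scaleC_add_right linear_add[OF u(1)])
  have scale: "f (c *\<^sub>C x) = c * f x" for c x
  proof -
    have c: "c = of_real (Re c) + of_real (Im c) * \<i>" by (simp add: complex_eq_iff)
    have 1: "c *\<^sub>C x = Re c *\<^sub>R x + Im c *\<^sub>R (\<i> *\<^sub>C x)"
      by (subst c) (simp only: scaleC_add_left scaleC_of_real scaleC_scaleC[symmetric])
    have "\<i> *\<^sub>C \<i> *\<^sub>C x = - x" by (simp add: scaleC_scaleC scaleC_minus_left)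
    then have 2: "\<i> *\<^sub>C c *\<^sub>C x = Re c *\<^sub>R (\<i> *\<^sub>C x) - Im c *\<^sub>R x"
      by (simp only: 1 scaleC_add_right scaleC_scaleR) simp
    show ?thesis unfolding f_def 2 unfolding 1
      by (simp add: complex_eq_iff linear_add[OF u(1)] linear_diff[OF u(1)] linear_scale[OF u(1)])
  qed
  have le: "cmod (f x) \<le> norm x" for x
  proof (cases "f x = 0")
    case False
    \<comment> \<open>The phase \<open>c\<close> rotates \<open>f x\<close> onto its modulus, which
      is then a value of \<open>u\<close>.\<close>
    define c where "c = cnj (f x) / of_real (cmod (f x))"
    have c: "cmod c = 1" using False by (simp add: c_def norm_divide)
    have "cnj (f x) * f x = of_real (cmod (f x)) * of_real (cmod (f x))"
      using complex_norm_square[of "f x"] by (simp add: power2_eq_square mult.commute)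
    then have "f (c *\<^sub>C x) = of_real (cmod (f x))"
      using False unfolding scale c_def by (simp add: divide_eq_eq)
    then have "cmod (f x) = u (c *\<^sub>C x)" by (simp add: f_def complex_eq_iff)
    also have "\<dots> \<le> norm x" using u(2)[of "c *\<^sub>C x"] by (simp add: norm_scaleC c)
    finally show ?thesis .
  qed simp
  have "f x0 = of_real (norm x0)"
  proof -
    have "Re (f x0) = norm x0" by (simp add: f_def u)
    \<comment> \<open>The real part already exhausts the bound on the modulus, so the imaginary part
      vanishes.\<close>
    moreover have "(cmod (f x0))\<^sup>2 \<le> (norm x0)\<^sup>2" using le by (intro power_mono) auto
    ultimately have "Im (f x0) = 0" by (simp add: cmod_power2)
    with \<open>Re (f x0) = norm x0\<close>
      show ?thesis by (simp add: complex_eq_iff)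
  qed
  moreover have "clin f" using add scale unfolding clin_iff by (simp add: scaleC_complex_def)
  ultimately show ?thesis using le by blast
qed

subsection \<open>Homogeneous polynomials\<close>

lemma clin_add: "clin f \<Longrightarrow> clin g \<Longrightarrow> clin (\<lambda>z. f z + g z)"
  unfolding clin_iff by (simp add: scaleC_add_right)

lemma homogeneous_poly_add:
  assumes "homogeneous_poly k P" "homogeneous_poly k Q"
  shows "homogeneous_poly k (\<lambda>z. P z + Q z)"
proof -
  obtain A B where "cont_sym_multilinear k A" "cont_sym_multilinear k B"
    and "\<And>x. P x = A (\<lambda>i\<in>{..<k}. x)" "\<And>x. Q x = B (\<lambda>i\<in>{..<k}. x)"
    using assms unfolding homogeneous_poly_def by blast
  then show ?thesis
    unfolding homogeneous_poly_def cont_sym_multilinear_def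
    by (intro exI[of _ "\<lambda>x. A x + B x"]) (auto intro: clin_add continuous_map_add)
qed

text \<open>The k slots are scaled one after another; each replacement of z by
  \<open>c *\<^sub>C z\<close> pulls out one factor c.\<close>

lemma homogeneous_poly_scaleC:
  assumes "homogeneous_poly k P"
  shows "P (c *\<^sub>C z) = c ^ k *\<^sub>C P z"
proof -
  obtain A where A: "cont_sym_multilinear k A" and P: "\<And>x. P x = A (\<lambda>i\<in>{..<k}. x)"
    using assms unfolding homogeneous_poly_def by blast
  have "A (\<lambda>i\<in>{..<k}. if i < m then c *\<^sub>C z else z) = c ^ m *\<^sub>C P z" if "m \<le> k" for m
    using that
  proof (induction m)
    case 0 then show ?case by (simp add: P restrict_def)
  next
    case (Suc m)
    define x where "x = (\<lambda>i\<in>{..<k}. if i < m then c *\<^sub>C z else z)"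
    have "clin (\<lambda>w. A (x(m := w)))"
      using A Suc.prems unfolding cont_sym_multilinear_def by (auto simp: x_def)
    then have "A (x(m := c *\<^sub>C z)) = c *\<^sub>C A (x(m := z))" by (simp add: clin_iff)
    moreover have "x(m := z) = x" using Suc.prems by (auto simp: x_def fun_eq_iff)
    moreover have "x(m := c *\<^sub>C z) = (\<lambda>i\<in>{..<k}. if i < Suc m then c *\<^sub>C z else z)"
      using Suc.prems by (auto simp: x_def fun_eq_iff)
    moreover have "A x = c ^ m *\<^sub>C P z"
      unfolding x_def by (rule Suc.IH) (use Suc.prems in simp)
    ultimately show ?case by (simp only: scaleC_scaleC power_Suc)
  qed
  from this[of k] have "A (\<lambda>i\<in>{..<k}. if i < k then c *\<^sub>C z else z) = c ^ k *\<^sub>C P z" by simp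
  moreover have "(\<lambda>i\<in>{..<k}. if i < k then c *\<^sub>C z else z) = (\<lambda>i\<in>{..<k}. c *\<^sub>C z)"
    by (auto simp: fun_eq_iff)
  ultimately show ?thesis by (simp only: P)
qed

lemma homogeneous_poly_continuous:
  assumes "homogeneous_poly k P"
  shows "continuous_on UNIV P"
proof -
  obtain A where A: "cont_sym_multilinear k A" and P: "\<And>x. P x = A (\<lambda>i\<in>{..<k}. x)"
    using assms unfolding homogeneous_poly_def by blast
  have "continuous_map euclidean (product_topology (\<lambda>_. euclidean) {..<k}) (\<lambda>x::'a. \<lambda>i\<in>{..<k}. x)"
    by (auto simp: continuous_map_componentwise)
  then have "continuous_map euclidean euclidean (A \<circ> (\<lambda>x::'a. \<lambda>i\<in>{..<k}. x))"
    using A unfolding cont_sym_multilinear_def by (blast intro: continuous_map_compose)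
  moreover have "A \<circ> (\<lambda>x::'a. \<lambda>i\<in>{..<k}. x) = P" by (auto simp: P fun_eq_iff)
  ultimately show ?thesis by simp
qed

text \<open>Continuity at 0 gives a bound on a small ball, and homogeneity carries it to the unit
  ball.\<close>

lemma homogeneous_poly_bounded:
  assumes "homogeneous_poly k P"
  obtains M where "\<And>z. norm z \<le> 1 \<Longrightarrow> norm (P z) \<le> M"
proof -
  have "isCont P 0"
    using homogeneous_poly_continuous[OF assms] continuous_on_eq_continuous_at[of UNIV P] by simp
  then obtain d where d: "d > 0" "\<And>z. dist z 0 < d \<Longrightarrow> dist (P z) (P 0) < 1"
    unfolding continuous_at_eps_delta by (metis zero_less_one)
  define e where "e = d / 2"
  have e: "e > 0" using d by (simp add: e_def)
  have "norm (P z) \<le> (norm (P 0) + 1) / e ^ k" if z: "norm z \<le> 1" for z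
  proof -
    have "e * norm z < d"
      using mult_left_mono[OF z less_imp_le[OF e]] d(1) by (simp add: e_def)
    then have "dist (P (of_real e *\<^sub>C z)) (P 0) < 1"
      using e by (intro d) (simp add: norm_scaleC)
    then have "norm (P (of_real e *\<^sub>C z)) \<le> norm (P 0) + 1"
      using norm_triangle_ineq2[of "P (of_real e *\<^sub>C z)" "P 0"] by (simp add: dist_norm)
    then show ?thesis
      using e by (simp add: homogeneous_poly_scaleC[OF assms] norm_scaleC norm_power field_simps)
  qed
  then show ?thesis by (rule that)
qed

lemma polys_upto_add:
  assumes "P \<in> polys_upto N" "Q \<in> polys_upto N"
  shows "(\<lambda>z. P z + Q z) \<in> polys_upto N"
proof -
  obtain p q where "\<forall>k\<le>N. homogeneous_poly k (p k)" "\<forall>k\<le>N. homogeneous_poly k (q k)"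
    and "P = (\<lambda>x. \<Sum>k\<le>N. p k x)" "Q = (\<lambda>x. \<Sum>k\<le>N. q k x)"
    using assms unfolding polys_upto_def by blast
  then show ?thesis unfolding polys_upto_def
    by (intro CollectI exI[of _ "\<lambda>k z. p k z + q k z"])
      (auto simp: sum.distrib intro: homogeneous_poly_add)
qed

lemma polys_upto_continuous:
  assumes "P \<in> polys_upto N" shows "continuous_on UNIV P"
proof -
  obtain p where "\<forall>k\<le>N. homogeneous_poly k (p k)" "P = (\<lambda>x. \<Sum>k\<le>N. p k x)"
    using assms unfolding polys_upto_def by blast
  moreover from this have "continuous_on UNIV (p k)" if "k \<le> N" for k
    using that homogeneous_poly_continuous by blast
  ultimately show ?thesis by (auto intro!: continuous_on_sum)
qed

lemma polys_upto_bounded: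
  assumes "P \<in> polys_upto N"
  obtains M where "\<And>z. norm z \<le> 1 \<Longrightarrow> norm (P z) \<le> M"
proof -
  obtain p where p: "\<forall>k\<le>N. homogeneous_poly k (p k)" and P: "P = (\<lambda>x. \<Sum>k\<le>N. p k x)"
    using assms unfolding polys_upto_def by blast
  have "\<forall>k. \<exists>M. k \<le> N \<longrightarrow> (\<forall>z. norm z \<le> 1 \<longrightarrow> norm (p k z) \<le> M)"
    using p by (metis homogeneous_poly_bounded)
  then obtain M where "\<And>k z. k \<le> N \<Longrightarrow> norm z \<le> 1 \<Longrightarrow> norm (p k z) \<le> M k" by metis
  then have "norm (P z) \<le> (\<Sum>k\<le>N. M k)" if "norm z \<le> 1" for z
    unfolding P using that by (intro sum_norm_le) auto
  then show ?thesis by (rule that)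
qed

text \<open>This reduction to one complex variable makes the maximum modulus principle applicable;
  \<open>w k\<close> is the value at z of the part of degree k.\<close>

lemma polys_upto_line:
  assumes "P \<in> polys_upto N"
  obtains w where "\<And>c. P (c *\<^sub>C z) = (\<Sum>k\<le>N. c ^ k *\<^sub>C w k)"
proof -
  obtain p where p: "\<forall>k\<le>N. homogeneous_poly k (p k)" and P: "P = (\<lambda>x. \<Sum>k\<le>N. p k x)"
    using assms unfolding polys_upto_def by blast
  then have "P (c *\<^sub>C z) = (\<Sum>k\<le>N. c ^ k *\<^sub>C p k z)" for c
    by (auto intro: sum.cong homogeneous_poly_scaleC)
  then show ?thesis by (rule that)
qed

section \<open>Polynomials built from powers of linear functionals\<close>

lemma clin_prod_fun_upd:
  assumes h: "clin (h :: 'a::complex_normed_vector \<Rightarrow> complex)" and j: "j < (k::nat)"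
  shows "(\<Prod>i<k. h ((x(j := z)) i)) = h z * (\<Prod>i\<in>{..<k} - {j}. h (x i))"
proof -
  have "(\<Prod>i<k. h ((x(j := z)) i)) = h ((x(j := z)) j) * (\<Prod>i\<in>{..<k} - {j}. h ((x(j := z)) i))"
    using j by (intro prod.remove) auto
  also have "(\<Prod>i\<in>{..<k} - {j}. h ((x(j := z)) i)) = (\<Prod>i\<in>{..<k} - {j}. h (x i))"
    by (intro prod.cong) auto
  finally show ?thesis by simp
qed

lemma clin_functional_continuous:
  assumes "clin (h :: 'a::complex_normed_vector \<Rightarrow> complex)" "\<And>z. cmod (h z) \<le> K * norm z"
  shows "continuous_on UNIV h"
proof -
  have "bounded_linear h"
  proof (rule bounded_linear_intro[where K = K])
    show "h (r *\<^sub>R x) = r *\<^sub>R h x" for r x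
      using assms(1) unfolding clin_iff by (metis scaleC_of_real)
  qed (use assms in \<open>auto simp: clin_iff mult.commute\<close>)
  then show ?thesis by (rule linear_continuous_on)
qed

text \<open>Weierstrass' test, for an abstract topology so that it applies to the product topology
  on extensional functions.\<close>

lemma continuous_map_suminf:
  fixes f :: "nat \<Rightarrow> 'a \<Rightarrow> 'b::banach"
  assumes f: "\<And>n. continuous_map X euclidean (f n)"
    and M: "\<And>n x. norm (f n x) \<le> M n" "summable M"
  shows "continuous_map X euclidean (\<lambda>x. \<Sum>n. f n x)"
proof -
  have "uniform_limit (topspace X) (\<lambda>n x. \<Sum>i<n. f i x) (\<lambda>x. \<Sum>i. f i x) sequentially"
    by (rule Weierstrass_m_test) (use M in auto)
  then have lim: "\<forall>\<^sub>F n in sequentially. \<forall>x\<in>topspace X. dist (\<Sum>i<n. f i x) (\<Sum>i. f i x) < e" if "e > 0" for e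
    using that by (auto simp: uniform_limit_iff)
  have "continuous_map X (Met_TC.mtopology) (\<lambda>x. \<Sum>n. f n x)"
    by (rule Met_TC.continuous_map_uniform_limit_alt[where F = sequentially and f = "\<lambda>n x. \<Sum>i<n. f i x"])
      (use lim f in \<open>auto intro!: continuous_map_sum always_eventually\<close>)
  then show ?thesis by simp
qed

text \<open>Infinitely many perturbations will be added to P, so their sum has to be a polynomial
  again. The symmetric form multiplies the values of \<open>h n\<close> over the k slots and sums
  over n. Continuity is the delicate point, since the terms are in general unbounded on the
  product.\<close>

lemma homogeneous_poly_power_series:
  fixes h :: "nat \<Rightarrow> 'a::complex_normed_vector \<Rightarrow> complex" and u :: "nat \<Rightarrow> 'b::complex_banach"
  assumes g: "summable (\<lambda>n. cmod (g n))"
    and h: "\<And>n. clin (h n)" "\<And>n z. cmod (h n z) \<le> K * norm z" and K: "K \<ge> 0"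
    and u: "\<And>n. norm (u n) \<le> 1"
  shows "homogeneous_poly k (\<lambda>z. \<Sum>n. (g n * h n z ^ k) *\<^sub>C u n)"
proof -
  interpret scaleC: bounded_bilinear "scaleC :: complex \<Rightarrow> 'b \<Rightarrow> 'b" by (rule bounded_bilinear_scaleC)
  define T where "T n x = (g n * (\<Prod>i<k. h n (x i))) *\<^sub>C u n" for n and x :: "nat \<Rightarrow> 'a"
  define A where "A x = (\<Sum>n. T n x)" for x
  \<comment> \<open>Used twice: with \<open>b i = K * norm (x i)\<close> for the terms
    \<open>T\<close>, and with constant \<open>b\<close> for the normalised terms
    \<open>S\<close>.\<close>
  have bd: "norm ((g n * (\<Prod>i<k. f i)) *\<^sub>C u n) \<le> cmod (g n) * (\<Prod>i<k. b i)"
    if "\<And>i. cmod (f i) \<le> b i" for n f b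
  proof -
    have "norm ((g n * (\<Prod>i<k. f i)) *\<^sub>C u n) \<le> cmod (g n * (\<Prod>i<k. f i)) * 1"
      unfolding norm_scaleC by (intro mult_left_mono u) auto
    also have "\<dots> \<le> cmod (g n) * (\<Prod>i<k. b i)"
      unfolding norm_mult prod_norm[symmetric] mult_1_right
      by (intro mult_left_mono prod_mono conjI that norm_ge_zero)
    finally show ?thesis .
  qed
  have summ: "summable (\<lambda>n. T n x)" for x
    unfolding T_def
    by (rule summable_comparison_test'[OF summable_mult2[OF g]], rule bd, rule h(2))
  have lin: "clin (\<lambda>z. A (x(j := z)))" if "j < k" for x j
  proof -
    \<comment> \<open>The changed slot j contributes the factor \<open>h n z\<close>; the other
      factor does not depend on z.\<close>
    have T: "T n (x(j := z)) = h n z *\<^sub>C (g n * (\<Prod>i\<in>{..<k} - {j}. h n (x i))) *\<^sub>C u n" for n z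
      unfolding T_def clin_prod_fun_upd[OF h(1) that] scaleC_scaleC by (simp only: mult_ac)
    have 1: "A (x(j := y + z)) = A (x(j := y)) + A (x(j := z))" for y z
    proof -
      have "T n (x(j := y + z)) = T n (x(j := y)) + T n (x(j := z))" for n
        using h(1)[of n] by (simp add: T clin_iff scaleC_add_left)
      then show ?thesis unfolding A_def by (simp add: suminf_add summ)
    qed
    have 2: "A (x(j := c *\<^sub>C z)) = c *\<^sub>C A (x(j := z))" for c z
    proof -
      have "T n (x(j := c *\<^sub>C z)) = c *\<^sub>C T n (x(j := z))" for n
        using h(1)[of n, unfolded clin_iff] by (simp add: T scaleC_complex_def scaleC_scaleC mult_ac)
      then show ?thesis unfolding A_def
        using bounded_linear.suminf[OF scaleC.bounded_linear_right summ[of "x(j := z)"], of c] by simp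
    qed
    show ?thesis unfolding clin_iff using 1 2 by blast
  qed
  have sym: "A (x \<circ> \<pi>) = A x" if "\<pi> permutes {..<k}" for x \<pi>
  proof -
    have "(\<Prod>i<k. h n ((x \<circ> \<pi>) i)) = (\<Prod>i<k. h n (x i))" for n
      using prod.permute[OF that, of "\<lambda>i. h n (x i)"] by (simp only: comp_def)
    then show ?thesis by (simp only: A_def T_def)
  qed
  have cont: "continuous_map (product_topology (\<lambda>_. euclidean) {..<k}) euclidean A"
  proof -
    let ?X = "product_topology (\<lambda>_. euclidean :: 'a topology) {..<k}"
    \<comment> \<open>After division by \<open>\<Prod>i<k. 1 + norm (x i)\<close> the series converges uniformly on the whole product.\<close>
    define S where "S n x = (g n * (\<Prod>i<k. h n (x i) / (1 + norm (x i)))) *\<^sub>C u n" for n and x :: "nat \<Rightarrow> 'a"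
    have proj: "continuous_map ?X euclidean (\<lambda>x. x i)" if "i < k" for i
      using that continuous_map_product_projection[of i "{..<k}" "\<lambda>_. euclidean"] by simp
    have c1: "continuous_map ?X euclidean (\<lambda>x. f (x i))" if "i < k" "continuous_on UNIV f"
      for i and f :: "'a \<Rightarrow> 'c::topological_space"
      using continuous_map_compose[OF proj[OF that(1)], of euclidean f] that(2) by (simp add: comp_def)
    have nz: "1 + complex_of_real (norm y) \<noteq> 0" for y :: 'a
      by (simp add: complex_eq_iff) (use norm_ge_zero[of y] in linarith)
    have "continuous_map ?X euclidean (\<lambda>x. \<Prod>i<k. h n (x i) / (1 + norm (x i)))" for n
    proof -
      have "continuous_on UNIV (\<lambda>y. h n y / (1 + norm y))"
        by (intro continuous_intros clin_functional_continuous[OF h(1) h(2)])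
          (auto simp: nz)
      then have "continuous_map ?X euclidean (\<lambda>x. h n (x i) / (1 + norm (x i)))" if "i < k" for i
        using c1[OF that, of "\<lambda>y. h n y / (1 + norm y)"] by simp
      then show ?thesis
        unfolding continuous_map_atin limitin_canonical_iff by (auto intro!: tendsto_prod)
    qed
    then have "continuous_map ?X euclidean ((\<lambda>w. (g n * w) *\<^sub>C u n) \<circ> (\<lambda>x. \<Prod>i<k. h n (x i) / (1 + norm (x i))))" for n
      by (rule continuous_map_compose) (auto intro!: scaleC.continuous_on continuous_intros)
    then have S: "continuous_map ?X euclidean (S n)" for n unfolding S_def comp_def .
    have bound: "cmod (h n y / (1 + norm y)) \<le> K" for n y
    proof -
      have "cmod (h n y) \<le> K * (1 + norm y)" using h(2)[of n y] K by (simp add: algebra_simps)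
      moreover have "cmod (1 + complex_of_real (norm y)) = 1 + norm y"
        using norm_of_real[of "1 + norm y", where 'a = complex] by simp
      ultimately show ?thesis by (simp add: norm_divide divide_le_eq add_pos_nonneg)
    qed
    have "continuous_map ?X euclidean (\<lambda>x. \<Sum>n. S n x)"
    proof (rule continuous_map_suminf[OF S])
      show "norm (S n x) \<le> cmod (g n) * K ^ k" for n x
        unfolding S_def using bd[of "\<lambda>i. h n (x i) / (1 + norm (x i))" "\<lambda>_. K" n] bound by simp
      show "summable (\<lambda>n. cmod (g n) * K ^ k)" by (rule summable_mult2[OF g])
    qed
    moreover have "continuous_map ?X euclidean (\<lambda>x. \<Prod>i<k. 1 + norm (x i))"
    proof -
      have "continuous_on UNIV (\<lambda>y::'a. 1 + norm y)" by (intro continuous_intros)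
      then have "continuous_map ?X euclidean (\<lambda>x. 1 + norm (x i))" if "i < k" for i
        using c1[OF that, of "\<lambda>y. 1 + norm y"] by simp
      then show ?thesis by (intro continuous_map_prod) auto
    qed
    ultimately have "continuous_map ?X euclidean (\<lambda>x. (\<Prod>i<k. 1 + norm (x i)) *\<^sub>R (\<Sum>n. S n x))"
      unfolding continuous_map_atin limitin_canonical_iff by (auto intro!: tendsto_scaleR)
    \<comment> \<open>Multiplication by the normalising product, which is positive and continuous,
      recovers \<open>A\<close>.\<close>
    moreover have "A x = (\<Prod>i<k. 1 + norm (x i)) *\<^sub>R (\<Sum>n. S n x)" for x
    proof -
      have prod_nz: "(\<Prod>i<k. 1 + norm (x i)) \<noteq> 0" by (simp add: add_nonneg_eq_0_iff)
      have ST: "T n x = (\<Prod>i<k. 1 + norm (x i)) *\<^sub>R S n x" for n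
      proof -
        have "(\<Prod>i<k. h n (x i)) = of_real (\<Prod>i<k. 1 + norm (x i)) * (\<Prod>i<k. h n (x i) / (1 + norm (x i)))"
          unfolding of_real_prod prod.distrib[symmetric]
          by (intro prod.cong) (auto simp: nz)
        then show ?thesis
          unfolding T_def S_def by (simp only: scaleC_of_real[symmetric] scaleC_scaleC mult_ac)
      qed
      have "summable (\<lambda>n. S n x)"
        using summable_scaleR_right[OF summ[of x], of "inverse (\<Prod>i<k. 1 + norm (x i))"] prod_nz
        by (simp add: ST)
      then show ?thesis unfolding A_def ST
        by (rule suminf_scaleR_right[symmetric])
    qed
    ultimately show ?thesis by presburger
  qed
  show ?thesis
    unfolding homogeneous_poly_def cont_sym_multilinear_def
  proof (intro exI[of _ A] conjI ballI allI impI)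
    show "(\<Sum>n. (g n * h n z ^ k) *\<^sub>C u n) = A (\<lambda>i\<in>{..<k}. z)" for z
      by (simp add: A_def T_def)
  qed (use lin sym cont in auto)
qed

text \<open>The binomial theorem sorts the terms by degree. As \<open>a n\<close> lies between 0 and
  1, the coefficient \<open>g k n\<close> has modulus at most \<open>c n * (N choose k)\<close>, so
  the series of each degree converges.\<close>

lemma polys_upto_power_series:
  fixes h :: "nat \<Rightarrow> 'a::complex_normed_vector \<Rightarrow> complex" and u :: "nat \<Rightarrow> 'b::complex_banach"
  assumes c: "summable c" "\<And>n. 0 \<le> c n" and a: "\<And>n. 0 \<le> a n" "\<And>n. a n \<le> 1"
    and h: "\<And>n. clin (h n)" "\<And>n z. cmod (h n z) \<le> K * norm z" and K: "K \<ge> 0"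
    and u: "\<And>n. norm (u n) \<le> 1"
  shows "(\<lambda>z. \<Sum>n. (of_real (c n) * (of_real (a n) + h n z) ^ N) *\<^sub>C u n) \<in> polys_upto N"
proof -
  define g where "g k n = complex_of_real (c n * (N choose k) * a n ^ (N - k))" for k n
  have g: "summable (\<lambda>n. cmod (g k n))" for k
  proof (rule summable_comparison_test'[OF summable_mult2[OF c(1), of "real (N choose k)"]])
    fix n
    have "c n * (N choose k) * a n ^ (N - k) \<le> c n * (N choose k) * 1"
      using a c by (intro mult_left_mono power_le_one) auto
    then show "norm (cmod (g k n)) \<le> c n * real (N choose k)"
      using a c unfolding g_def norm_of_real by (simp add: abs_mult)
  qed
  have summ: "summable (\<lambda>n. (g k n * h n z ^ k) *\<^sub>C u n)" for k z
  proof (rule summable_comparison_test'[OF summable_mult2[OF g, of k "(K * norm z) ^ k"]])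
    fix n
    have "norm ((g k n * h n z ^ k) *\<^sub>C u n) \<le> cmod (g k n * h n z ^ k) * 1"
      unfolding norm_scaleC by (intro mult_left_mono u norm_ge_zero)
    also have "\<dots> \<le> cmod (g k n) * (K * norm z) ^ k"
      unfolding norm_mult norm_power mult_1_right by (intro mult_left_mono power_mono h norm_ge_zero)
    finally show "norm ((g k n * h n z ^ k) *\<^sub>C u n) \<le> cmod (g k n) * (K * norm z) ^ k" .
  qed
  have "(of_real (c n) * (of_real (a n) + h n z) ^ N) *\<^sub>C u n = (\<Sum>k\<le>N. (g k n * h n z ^ k) *\<^sub>C u n)" for n z
    unfolding scaleC_sum_left[symmetric] add.commute[of "of_real (a n)"] binomial_ring sum_distrib_left
    by (intro arg_cong2[where f = scaleC] sum.cong refl) (simp add: g_def)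
  then have "(\<Sum>n. (of_real (c n) * (of_real (a n) + h n z) ^ N) *\<^sub>C u n)
      = (\<Sum>k\<le>N. \<Sum>n. (g k n * h n z ^ k) *\<^sub>C u n)" for z
    by (simp add: suminf_sum summ)
  then show ?thesis
    unfolding polys_upto_def
    by (intro CollectI exI[of _ "\<lambda>k z. \<Sum>n. (g k n * h n z ^ k) *\<^sub>C u n"])
      (auto intro!: homogeneous_poly_power_series[where K = K] g h K u)
qed

lemma polys_upto_power:
  fixes h :: "'a::complex_normed_vector \<Rightarrow> complex" and u :: "'b::complex_banach"
  assumes "0 \<le> c" "0 \<le> a" "a \<le> 1" "clin h" "\<And>z. cmod (h z) \<le> K * norm z" "K \<ge> 0" "norm u \<le> 1"
  shows "(\<lambda>z. (of_real c * (of_real a + h z) ^ N) *\<^sub>C u) \<in> polys_upto N"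
proof -
  define d where "d n = (if n = (0::nat) then c else 0)" for n
  have "(\<Sum>n. (of_real (d n) * (of_real a + h z) ^ N) *\<^sub>C u)
      = (\<Sum>n\<in>{0}. (of_real (d n) * (of_real a + h z) ^ N) *\<^sub>C u)" for z
    by (rule suminf_finite) (auto simp: d_def)
  moreover have "(\<lambda>z. \<Sum>n. (of_real (d n) * (of_real a + h z) ^ N) *\<^sub>C u) \<in> polys_upto N"
  proof (rule polys_upto_power_series[where K = K])
    show "summable d" by (rule summable_finite[of "{0}"]) (auto simp: d_def)
  qed (use assms in \<open>auto simp: d_def\<close>)
  ultimately show ?thesis by (simp add: d_def)
qed

subsection \<open>Moving almost maximal points inwards\<close>

text \<open>A norming functional at \<open>p c\<close> makes the polynomial scalar without loss at
  c. The maximum modulus principle for the reversed polynomial at \<open>inverse c\<close> then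
  compares with the unit circle, on which \<open>norm (p \<zeta>)\<close> is maximal.\<close>

lemma polynomial_growth:
  fixes w :: "nat \<Rightarrow> 'b::complex_normed_vector"
  assumes c: "cmod c \<ge> 1"
  obtains \<zeta> where "cmod \<zeta> = 1"
    "norm (\<Sum>k\<le>N. c ^ k *\<^sub>C w k) \<le> cmod c ^ N * norm (\<Sum>k\<le>N. \<zeta> ^ k *\<^sub>C w k)"
proof -
  interpret scaleC: bounded_bilinear "scaleC :: complex \<Rightarrow> 'b \<Rightarrow> 'b" by (rule bounded_bilinear_scaleC)
  define p where "p \<zeta> = (\<Sum>k\<le>N. \<zeta> ^ k *\<^sub>C w k)" for \<zeta>
  have "continuous_on (sphere 0 1) (\<lambda>\<zeta>. norm (p \<zeta>))"
    unfolding p_def by (intro continuous_intros scaleC.continuous_on)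
  then obtain \<zeta> where \<zeta>: "cmod \<zeta> = 1" and max: "\<And>\<xi>. cmod \<xi> = 1 \<Longrightarrow> norm (p \<xi>) \<le> norm (p \<zeta>)"
    using continuous_attains_sup[of "sphere (0::complex) 1" "\<lambda>\<zeta>. norm (p \<zeta>)"] by auto
  obtain f where f: "clin f" "\<And>y. cmod (f y) \<le> norm y" "f (p c) = of_real (norm (p c))"
    using Hahn_Banach_complex[of "p c"] by blast
  have f_add: "f (x + y) = f x + f y" and f_scale: "f (d *\<^sub>C x) = d * f x" for x y d
    using f(1)[unfolded clin_iff] by (auto simp: scaleC_complex_def)
  have f_0: "f 0 = 0" using f(2)[of 0] by simp
  have f_p: "f (p \<xi>) = (\<Sum>k\<le>N. \<xi> ^ k * f (w k))" for \<xi>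
  proof -
    have "f (\<Sum>k\<in>I. \<xi> ^ k *\<^sub>C w k) = (\<Sum>k\<in>I. \<xi> ^ k * f (w k))" if "finite I" for I
      using that by (induction I) (simp_all add: f_0 f_add f_scale)
    then show ?thesis by (simp add: p_def)
  qed
  \<comment> \<open>The reversed polynomial \<open>\<mu>\<^sup>N f (p (1 / \<mu>))\<close>, to which the maximum modulus principle applies on the disc.\<close>
  define q where "q \<mu> = (\<Sum>k\<le>N. \<mu> ^ (N - k) * f (w k))" for \<mu>
  have q: "q \<mu> = \<mu> ^ N * f (p (inverse \<mu>))" if "\<mu> \<noteq> 0" for \<mu>
    unfolding q_def f_p sum_distrib_left
    using that by (intro sum.cong) (auto simp: power_diff power_inverse field_simps)
  have "cmod (q (inverse c)) \<le> norm (p \<zeta>)"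
  proof (rule maximum_modulus_frontier[of q "cball 0 1"])
    show "q holomorphic_on interior (cball 0 1)" unfolding q_def by (intro holomorphic_intros)
    show "continuous_on (closure (cball 0 1)) q" unfolding q_def by (intro continuous_intros)
    show "cmod (q z) \<le> norm (p \<zeta>)" if "z \<in> frontier (cball 0 1)" for z
    proof -
      have z: "cmod z = 1" using that by (simp add: frontier_cball)
      then have "cmod (q z) = cmod (f (p (inverse z)))"
        by (subst q) (auto simp: norm_mult norm_power)
      also have "\<dots> \<le> norm (p (inverse z))" by (rule f)
      also have "\<dots> \<le> norm (p \<zeta>)" using z by (intro max) (simp add: norm_inverse)
      finally show ?thesis .
    qed
    show "inverse c \<in> cball 0 1" using c by (simp add: norm_inverse inverse_le_1_iff)
  qed simp
  moreover have "norm (p c) = cmod c ^ N * cmod (q (inverse c))"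
  proof -
    have "c \<noteq> 0" using c by auto
    then have "cmod c ^ N * cmod (q (inverse c)) = cmod (f (p c))"
      by (subst q) (simp_all add: norm_mult norm_power norm_inverse power_inverse)
    then show ?thesis by (simp add: f(3))
  qed
  ultimately have "norm (p c) \<le> cmod c ^ N * norm (p \<zeta>)" by (simp add: mult_left_mono)
  with \<zeta> show ?thesis unfolding p_def by (rule that)
qed

text \<open>
  The condition on \<open>b\<close> says that \<open>s \<mapsto> (1 - s\<^sup>2) (1 + b (s - r))\<^sup>N\<close> has a critical point at \<open>r\<close>.
\<close>

lemma peak_estimate:
  fixes r s t b :: real
  assumes r: "0 \<le> r" "r < 1" and s: "0 \<le> s" "s < 1" and t: "t \<le> s"
    and b: "of_nat N * b * (1 - r\<^sup>2) = 2 * r" and nonneg: "0 \<le> 1 + b * (t - r)"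
  shows "(1 - s\<^sup>2) * (1 + b * (t - r)) ^ N \<le> (1 - r\<^sup>2) * exp (- ((s - r)\<^sup>2 + 2 * r * (s - t)))"
proof -
  define D where "D = (s - r)\<^sup>2 + 2 * r * (s - t)"
  have r2: "1 - r\<^sup>2 > 0" "1 - r\<^sup>2 \<le> 1" using r by (simp_all add: power_less_one_iff abs_square_less_1)
  have s2: "0 \<le> 1 - s\<^sup>2" using s by (simp add: power_le_one)
  have D0: "D \<ge> 0" unfolding D_def using r t by simp
  \<comment> \<open>Both factors are estimated by \<open>1 + u \<le> exp u\<close>, so that only
    exponents remain to be added.\<close>
  have "(1 + b * (t - r)) ^ N \<le> exp (b * (t - r)) ^ N"
    using nonneg by (intro power_mono) auto
  also have "\<dots> = exp (N * (b * (t - r)))" by (simp add: exp_of_nat_mult)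
  finally have 1: "(1 + b * (t - r)) ^ N \<le> exp (N * (b * (t - r)))" .
  define E where "E = (s\<^sup>2 - r\<^sup>2) / (1 - r\<^sup>2)"
  have "1 - s\<^sup>2 = (1 - r\<^sup>2) * (1 + - E)" using r2 by (simp add: E_def field_simps)
  also have "\<dots> \<le> (1 - r\<^sup>2) * exp (- E)" using r2 by (intro mult_left_mono exp_ge_add_one_self) auto
  finally have 2: "1 - s\<^sup>2 \<le> (1 - r\<^sup>2) * exp (- E)" .
  have "(1 - s\<^sup>2) * (1 + b * (t - r)) ^ N \<le> ((1 - r\<^sup>2) * exp (- E)) * exp (N * (b * (t - r)))"
    using 1 2 s2 r2 nonneg by (intro mult_mono) auto
  also have "\<dots> = (1 - r\<^sup>2) * exp (N * b * (t - r) - E)" by (simp add: mult.assoc flip: exp_add)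
  \<comment> \<open>By the critical-point condition the exponents combine into a multiple of
    \<open>D\<close>, which measures the radial error \<open>s - r\<close> and the defect
    \<open>s - t\<close>.\<close>
  also have "N * b * (t - r) - E = - (D / (1 - r\<^sup>2))"
  proof -
    have "N * b = 2 * r / (1 - r\<^sup>2)" using b r2 by (subst eq_divide_eq) simp
    then have "N * b * (t - r) - E = (2 * r * (t - r) - (s\<^sup>2 - r\<^sup>2)) / (1 - r\<^sup>2)"
      by (simp add: E_def diff_divide_distrib)
    also have "2 * r * (t - r) - (s\<^sup>2 - r\<^sup>2) = - D" by (simp add: D_def power2_eq_square algebra_simps)
    finally show ?thesis by simp
  qed
  also have "(1 - r\<^sup>2) * exp (- (D / (1 - r\<^sup>2))) \<le> (1 - r\<^sup>2) * exp (- D)"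
  proof -
    have "D * (1 - r\<^sup>2) \<le> D * 1" using D0 r2 by (intro mult_left_mono) auto
    then have "D \<le> D / (1 - r\<^sup>2)" using r2 by (simp add: field_simps)
    then show ?thesis using r2 by simp
  qed
  finally show ?thesis by (simp add: D_def)
qed

text \<open>The radius bound gives \<open>1 - (norm y)\<^sup>2 \<ge> 2 / (N + 2)\<close>, a uniform
  distance from the unit sphere. Moving inwards costs nothing: beyond the critical radius the decay
  of the weight beats the growth of order N that the maximum modulus principle allows.\<close>

lemma polys_upto_move_inwards:
  assumes P: "P \<in> polys_upto N" and x: "norm x < 1"
  obtains c where "(real N + 2) * (norm (c *\<^sub>C x))\<^sup>2 \<le> real N"
    "(1 - (norm x)\<^sup>2) * norm (P x) \<le> (1 - (norm (c *\<^sub>C x))\<^sup>2) * norm (P (c *\<^sub>C x))"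
proof -
  consider "(real N + 2) * (norm x)\<^sup>2 \<le> real N" | "N = 0" | "N > 0" "(real N + 2) * (norm x)\<^sup>2 > real N"
    by linarith
  then show ?thesis
  proof cases
    case 1 then show ?thesis by (intro that[of 1]) auto
  next
    case 2
    \<comment> \<open>A constant is best evaluated at the origin, where the weight is 1.\<close>
    obtain w where w: "\<And>c. P (c *\<^sub>C x) = (\<Sum>k\<le>N. c ^ k *\<^sub>C w k)"
      using polys_upto_line[OF P] by blast
    have "P x = P (0 *\<^sub>C x)" using w[of 0] w[of 1] 2 by simp
    moreover have "(1 - (norm x)\<^sup>2) * norm (P x) \<le> 1 * norm (P x)" by (intro mult_right_mono) auto
    ultimately show ?thesis using 2 by (intro that[of 0]) auto
  next
    case 3
    \<comment> \<open>The maximiser of \<open>(1 - s\<^sup>2) * s ^ N\<close> on [0, 1].\<close>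
    define \<rho> where "\<rho> = sqrt (real N / (real N + 2))"
    have \<rho>2: "\<rho>\<^sup>2 = real N / (real N + 2)" by (simp add: \<rho>_def)
    have \<rho>: "\<rho> > 0" "\<rho> < 1" using 3 by (simp_all add: \<rho>_def)
    have "\<rho>\<^sup>2 < (norm x)\<^sup>2" using 3 by (simp add: \<rho>2 divide_less_eq mult.commute)
    then have \<rho>x: "\<rho> < norm x" by (rule power2_less_imp_less) simp
    \<comment> \<open>The factor \<open>1 / t\<close> leads from radius \<open>\<rho>\<close> back
      to x; the growth bound for it supplies the competitor y of norm \<open>\<rho>\<close>.\<close>
    define t where "t = \<rho> / norm x"
    have nx: "norm x > 0" using \<rho> \<rho>x by linarith
    have t: "0 < t" "t \<le> 1" using \<rho> \<rho>x nx unfolding t_def by (simp_all add: divide_le_eq)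
    obtain w where w: "\<And>c. P (c *\<^sub>C of_real t *\<^sub>C x) = (\<Sum>k\<le>N. c ^ k *\<^sub>C w k)"
      using polys_upto_line[OF P] by blast
    have "cmod (of_real (1 / t)) \<ge> 1" using t by (simp add: norm_divide)
    from polynomial_growth[OF this, where N = N and w = w] obtain \<zeta> where \<zeta>: "cmod \<zeta> = 1"
      "norm (P (of_real (1 / t) *\<^sub>C of_real t *\<^sub>C x)) \<le> cmod (of_real (1 / t)) ^ N * norm (P (\<zeta> *\<^sub>C of_real t *\<^sub>C x))"
      unfolding w by blast
    define y where "y = (\<zeta> * of_real t) *\<^sub>C x"
    have "norm y = t * norm x" using \<zeta>(1) t by (simp add: y_def norm_scaleC norm_mult)
    then have y: "norm y = \<rho>" using nx by (simp add: t_def)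
    have Px: "norm (P x) \<le> (norm x / \<rho>) ^ N * norm (P y)"
      using \<zeta>(2) t \<rho> by (simp add: scaleC_scaleC y_def norm_divide) (simp add: t_def)
    \<comment> \<open>The critical-point condition of \<open>peak_estimate\<close> for slope
      \<open>1 / \<rho>\<close>, with which the affine function there becomes
      \<open>s / \<rho>\<close>.\<close>
    have N\<rho>: "real N * (1 / \<rho>) * (1 - \<rho>\<^sup>2) = 2 * \<rho>"
    proof -
      have "real N * (1 - \<rho>\<^sup>2) = 2 * \<rho>\<^sup>2" by (simp add: \<rho>2 field_simps)
      then show ?thesis using \<rho> by (simp add: field_simps power2_eq_square)
    qed
    have "(1 - (norm x)\<^sup>2) * (norm x / \<rho>) ^ N \<le> 1 - \<rho>\<^sup>2"
    proof -
      have eq: "1 + (1 / \<rho>) * (norm x - \<rho>) = norm x / \<rho>" using \<rho> by (simp add: field_simps)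
      have "(1 - (norm x)\<^sup>2) * (norm x / \<rho>) ^ N \<le> (1 - \<rho>\<^sup>2) * exp (- ((norm x - \<rho>)\<^sup>2))"
        using peak_estimate[of \<rho> "norm x" "norm x" N "1 / \<rho>", OF _ _ _ _ _ N\<rho>, unfolded eq] \<rho> x by simp
      also have "\<dots> \<le> (1 - \<rho>\<^sup>2) * 1" using \<rho> by (intro mult_left_mono) (auto simp: power_le_one)
      finally show ?thesis by simp
    qed
    then have "(1 - (norm x)\<^sup>2) * (norm x / \<rho>) ^ N * norm (P y) \<le> (1 - \<rho>\<^sup>2) * norm (P y)"
      by (rule mult_right_mono) simp
    moreover have "(1 - (norm x)\<^sup>2) * norm (P x) \<le> (1 - (norm x)\<^sup>2) * ((norm x / \<rho>) ^ N * norm (P y))"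
      using x by (intro mult_left_mono Px) (simp add: power_le_one)
    ultimately have "(1 - (norm x)\<^sup>2) * norm (P x) \<le> (1 - (norm y)\<^sup>2) * norm (P y)"
      by (simp add: y mult.assoc)
    moreover have "(real N + 2) * (norm y)\<^sup>2 \<le> real N" by (simp add: y \<rho>2)
    ultimately show ?thesis unfolding y_def by (rule that[rotated])
  qed
qed

subsection \<open>Peak polynomials\<close>

text \<open>The peak polynomial is the N-th power of \<open>a + h\<close>. Its bounds do not depend
  on x and keep its modulus at most \<open>4 ^ N\<close> on the unit ball. The phase
  \<open>\<beta>\<close> is unavoidable: for \<open>a = 0\<close> the modulus is constant on the
  circle of all rotations of x.\<close>

definition peaks_at :: "nat \<Rightarrow> real \<Rightarrow> real \<Rightarrow> 'a \<Rightarrow> real \<Rightarrow> ('a::complex_normed_vector \<Rightarrow> complex) \<Rightarrow> bool"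
  where "peaks_at N \<epsilon> \<omega> x a h \<longleftrightarrow> 0 \<le> a \<and> a \<le> 1 \<and> clin h \<and> (\<forall>z. cmod (h z) \<le> 3 * norm z) \<and>
    of_real a + h x = 1 \<and>
    (\<forall>z\<in>ball 0 1. (1 - (norm x)\<^sup>2) - \<omega> \<le> (1 - (norm z)\<^sup>2) * cmod (of_real a + h z) ^ N \<longrightarrow>
      (\<exists>\<beta>. cmod \<beta> = 1 \<and> norm (z - \<beta> *\<^sub>C x) \<le> \<epsilon>))"

text \<open>\<open>h\<close> is a multiple of a norming functional f at x. By
  \<open>peak_estimate\<close>, an almost maximal z has nearly the norm of x, and away from the
  origin f nearly norms z up to a phase; uniform convexity then brings the directions together.
  \<open>\<omega>\<close> is uniform in x because the weight at x is at least
  \<open>2 / (N + 2)\<close>.\<close>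

lemma peak_polynomial_exists:
  assumes uc: "uniformly_convex TYPE('a::complex_normed_vector)" and \<epsilon>: "\<epsilon> > 0"
  shows "\<exists>\<omega>>0. \<forall>x::'a. (real N + 2) * (norm x)\<^sup>2 \<le> real N \<longrightarrow> (\<exists>a h. peaks_at N \<epsilon> \<omega> x a h)"
proof -
  have "\<epsilon> / 2 > 0" using \<epsilon> by simp
  then obtain \<delta> where \<delta>: "\<delta> > 0" and conv: "\<And>x y :: 'a. norm x = 1 \<Longrightarrow> norm y = 1 \<Longrightarrow>
      norm (x - y) \<ge> \<epsilon> / 2 \<Longrightarrow> norm ((x + y) /\<^sub>R 2) \<le> 1 - \<delta>"
    using uc unfolding uniformly_convex_def by meson
  \<comment> \<open>\<open>\<tau>\<close> separates points near the origin, which have no usable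
    direction, from the others. The first entry of \<open>\<kappa>\<close> will give
    \<open>\<bar>s - r\<bar> \<le> \<tau> / 2\<close>, the second
    \<open>s - t \<le> \<delta> * s\<close> and \<open>t > 0\<close>.\<close>
  define \<tau> where "\<tau> = \<epsilon> / 4"
  define \<kappa> where "\<kappa> = min ((\<tau> / 2)\<^sup>2) (min \<delta> (1 / 2) * \<tau>\<^sup>2)"
  have \<tau>: "\<tau> > 0" using \<epsilon> by (simp add: \<tau>_def)
  have \<kappa>: "\<kappa> > 0" using \<tau> \<delta> by (simp add: \<kappa>_def)
  \<comment> \<open>A loss of \<open>\<omega>\<close> is at most the fraction
    \<open>1 - exp (- \<kappa>)\<close> of the maximum, and hence forces
    \<open>D \<le> \<kappa>\<close>.\<close>
  define \<omega> where "\<omega> = (1 - exp (- \<kappa>)) * (2 / (real N + 2))"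
  have \<omega>: "\<omega> > 0" using \<kappa> by (simp add: \<omega>_def)
  show ?thesis
  proof (rule exI[of _ \<omega>], intro conjI allI impI \<omega>)
    fix x0 :: 'a assume x0: "(real N + 2) * (norm x0)\<^sup>2 \<le> real N"
    define r where "r = norm x0"
    have r0: "r \<ge> 0" by (simp add: r_def)
    have r2: "2 / (real N + 2) \<le> 1 - r\<^sup>2" using x0 by (simp add: r_def field_simps)
    then have r1: "1 - r\<^sup>2 > 0" by (rule less_le_trans[rotated]) simp
    then have r: "r < 1" using r0 by (simp add: power_less_one_iff)
    \<comment> \<open>The solution of the critical-point condition at radius r. For
      \<open>N = 0\<close> division by zero yields 0, which is right because the radius bound then
      gives \<open>r = 0\<close>.\<close>
    define b where "b = 2 * r / (real N * (1 - r\<^sup>2))"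
    have b: "real N * b * (1 - r\<^sup>2) = 2 * r"
    proof (cases "N = 0")
      case True then show ?thesis using x0 by (simp add: r_def)
    next
      case False then show ?thesis using r1 by (simp add: b_def)
    qed
    have b0: "b \<ge> 0" using r0 r1 by (simp add: b_def)
    \<comment> \<open>For positive N the radius bound is equivalent to \<open>b * r \<le> 1\<close>,
      which makes \<open>a \<ge> 0\<close>. The constant 3 comes from
      \<open>N * (2 / (N + 2)) \<ge> 2 / 3\<close> and \<open>r < 1\<close>.\<close>
    have br: "b * r \<le> 1" and b3: "b \<le> 3"
    proof -
      have "b * r \<le> 1 \<and> b \<le> 3"
      proof (cases "N = 0")
        case True then show ?thesis by (simp add: b_def)
      next
        case False
        have "2 * r\<^sup>2 \<le> real N * (1 - r\<^sup>2)" using x0 by (simp add: r_def algebra_simps)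
        then have "b * r \<le> 1" using False r1 by (simp add: b_def power2_eq_square)
        moreover have "2 * r \<le> 3 * (real N * (1 - r\<^sup>2))"
        proof -
          have "real N * (2 / (real N + 2)) \<le> real N * (1 - r\<^sup>2)" using r2 by (intro mult_left_mono) auto
          moreover have "2 / 3 \<le> real N * (2 / (real N + 2))" using False by (simp add: field_simps)
          ultimately show ?thesis using r by linarith
        qed
        then have "b \<le> 3" using False r1 by (simp add: b_def divide_le_eq)
        ultimately show ?thesis by simp
      qed
      then show "b * r \<le> 1" "b \<le> 3" by auto
    qed
    obtain f :: "'a \<Rightarrow> complex" where f: "clin f" "\<And>y. cmod (f y) \<le> norm y" "f x0 = of_real r"
      using Hahn_Banach_complex[of x0] unfolding r_def by blast
    have f_add: "f (x + y) = f x + f y" and f_scale: "f (d *\<^sub>C x) = d * f x" for x y d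
      using f(1)[unfolded clin_iff] by (auto simp: scaleC_complex_def)
    have f_scaleR: "f (d *\<^sub>R x) = of_real d * f x" for d x
      using f_scale[of "of_real d" x] by (simp add: scaleC_of_real)
    define a where "a = 1 - b * r"
    define h where "h z = of_real b * f z" for z
    have "\<exists>\<beta>. cmod \<beta> = 1 \<and> norm (z - \<beta> *\<^sub>C x0) \<le> \<epsilon>"
      if z: "norm z < 1" and near: "(1 - r\<^sup>2) - \<omega> \<le> (1 - (norm z)\<^sup>2) * cmod (of_real a + h z) ^ N" for z
    proof -
      define s where "s = norm z"
      define t where "t = cmod (f z)"
      have s: "0 \<le> s" "s < 1" and t: "0 \<le> t" "t \<le> s" using z f(2) by (simp_all add: s_def t_def)
      have eq: "a + b * t = 1 + b * (t - r)" by (simp add: a_def algebra_simps)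
      have nonneg: "0 \<le> 1 + b * (t - r)" unfolding eq[symmetric] using br b0 t by (simp add: a_def)
      have "cmod (of_real a + h z) \<le> cmod (of_real a) + cmod (h z)" by (rule norm_triangle_ineq)
      also have "\<dots> = a + b * t"
        unfolding h_def norm_mult norm_of_real t_def using br b0 by (simp add: a_def)
      finally have "cmod (of_real a + h z) ^ N \<le> (1 + b * (t - r)) ^ N"
        unfolding eq by (rule power_mono) simp
      define D where "D = (s - r)\<^sup>2 + 2 * r * (s - t)"
      have "(1 - r\<^sup>2) - \<omega> \<le> (1 - s\<^sup>2) * cmod (of_real a + h z) ^ N" using near by (simp add: s_def)
      also have "\<dots> \<le> (1 - s\<^sup>2) * (1 + b * (t - r)) ^ N"
        using \<open>cmod (of_real a + h z) ^ N \<le> _\<close> s by (intro mult_left_mono) (auto simp: power_le_one)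
      also have "\<dots> \<le> (1 - r\<^sup>2) * exp (- D)"
        unfolding D_def using r0 r s t b nonneg by (intro peak_estimate)
      finally have "(1 - r\<^sup>2) - \<omega> \<le> (1 - r\<^sup>2) * exp (- D)" .
      moreover have "\<omega> \<le> (1 - exp (- \<kappa>)) * (1 - r\<^sup>2)"
        unfolding \<omega>_def using r2 \<kappa> by (intro mult_left_mono) auto
      ultimately have "(1 - r\<^sup>2) * exp (- \<kappa>) \<le> (1 - r\<^sup>2) * exp (- D)" by (simp add: algebra_simps)
      then have "D \<le> \<kappa>" using r1 by simp
      have "(s - r)\<^sup>2 \<le> \<kappa>" using \<open>D \<le> \<kappa>\<close> r0 t unfolding D_def
        by (smt (verit) mult_nonneg_nonneg)
      also have "\<kappa> \<le> (\<tau> / 2)\<^sup>2" by (simp add: \<kappa>_def)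
      finally have sr: "\<bar>s - r\<bar> \<le> \<tau> / 2" using \<tau> by (simp add: abs_le_square_iff[symmetric])
      show ?thesis
      proof (cases "r < \<tau>")
        case True
        \<comment> \<open>Both points are so close to the origin that the triangle inequality
          suffices, with trivial phase.\<close>
        have "norm (z - 1 *\<^sub>C x0) \<le> s + r" using norm_triangle_ineq4[of z x0] by (simp add: s_def r_def)
        also have "\<dots> \<le> \<epsilon>" using True sr \<tau> unfolding \<tau>_def by linarith
        finally show ?thesis by (intro exI[of _ 1]) simp
      next
        case False
        then have rt: "r \<ge> \<tau>" by simp
        have st: "s \<ge> \<tau> / 2" using sr rt by linarith
        have s_pos: "s > 0" and r_pos: "r > 0" using st rt \<tau> by linarith+
        have "2 * \<tau> * (s - t) \<le> 2 * r * (s - t)" using rt t by (intro mult_right_mono) auto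
        also have "\<dots> \<le> \<kappa>" using \<open>D \<le> \<kappa>\<close> unfolding D_def by (smt (verit) zero_le_power2)
        finally have "2 * \<tau> * (s - t) \<le> min \<delta> (1 / 2) * \<tau>\<^sup>2" by (simp add: \<kappa>_def)
        then have "\<tau> * (2 * (s - t)) \<le> \<tau> * (min \<delta> (1 / 2) * \<tau>)" by (simp add: power2_eq_square mult_ac)
        then have "2 * (s - t) \<le> min \<delta> (1 / 2) * \<tau>" using \<tau> by (simp only: mult_le_cancel_left_pos)
        also have "\<dots> \<le> min \<delta> (1 / 2) * (2 * s)" using st \<delta> by (intro mult_left_mono) auto
        finally have "s - t \<le> min \<delta> (1 / 2) * s" by simp
        moreover have "min \<delta> (1 / 2) * s \<le> \<delta> * s" "min \<delta> (1 / 2) * s \<le> 1 / 2 * s"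
          using s(1) by (auto intro: mult_right_mono simp only: min.cobounded1 min.cobounded2)
        ultimately have sd: "s - t \<le> \<delta> * s" "s - t \<le> 1 / 2 * s" by linarith+
        then have t_pos: "t > 0" using s_pos by linarith
        \<comment> \<open>The phase of \<open>f z\<close>; once it is removed, \<open>f z'\<close>
          is the positive number t.\<close>
        define \<beta> where "\<beta> = f z / of_real t"
        have \<beta>: "cmod \<beta> = 1" using t_pos by (simp add: \<beta>_def norm_divide t_def)
        have \<beta>cnj: "\<beta> * cnj \<beta> = 1" using complex_norm_square[of \<beta>] \<beta> by simp
        have fz: "f z = of_real t * \<beta>" using t_pos by (simp add: \<beta>_def)
        define z' where "z' = cnj \<beta> *\<^sub>C z"
        have nz': "norm z' = s" using \<beta> by (simp add: z'_def norm_scaleC s_def)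
        have fz': "f z' = of_real t" using \<beta>cnj by (simp add: z'_def f_scale fz mult_ac)
        define p q where "p = z' /\<^sub>R s" and "q = x0 /\<^sub>R r"
        have pq: "norm p = 1" "norm q = 1" using nz' s_pos r_pos by (simp_all add: p_def q_def r_def)
        \<comment> \<open>Otherwise the midpoint has norm at most \<open>1 - \<delta>\<close>, while
          f takes there the value \<open>(t / s + 1) / 2\<close>, which is at least
          \<open>1 - \<delta> / 2\<close>.\<close>
        have "norm (p - q) < \<epsilon> / 2"
        proof (rule ccontr)
          assume "\<not> norm (p - q) < \<epsilon> / 2"
          then have "norm ((p + q) /\<^sub>R 2) \<le> 1 - \<delta>" using conv[OF pq] by simp
          moreover have "f ((p + q) /\<^sub>R 2) = of_real ((t / s + 1) / 2)"
            using r_pos by (simp add: f_scaleR f_add p_def q_def fz' f(3) field_simps)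
          then have "(t / s + 1) / 2 \<le> norm ((p + q) /\<^sub>R 2)"
            using f(2)[of "(p + q) /\<^sub>R 2"] t s by (simp del: of_real_add of_real_divide)
          ultimately have "(t / s + 1) / 2 \<le> 1 - \<delta>" by linarith
          then have "2 * \<delta> * s \<le> s - t" using s_pos by (simp add: field_simps)
          moreover have "\<delta> * s > 0" using \<delta> s_pos by simp
          ultimately show False using sd(1) by linarith
        qed
        have "z - \<beta> *\<^sub>C x0 = \<beta> *\<^sub>C (z' - x0)"
          using \<beta>cnj by (simp add: z'_def scaleC_diff_right scaleC_scaleC)
        then have "norm (z - \<beta> *\<^sub>C x0) = norm (z' - x0)" using \<beta> by (simp add: norm_scaleC)
        also have "z' - x0 = s *\<^sub>R (p - q) + (s - r) *\<^sub>R q"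
        proof -
          have "z' = s *\<^sub>R p" "x0 = r *\<^sub>R q" using s_pos r_pos by (simp_all add: p_def q_def)
          then show ?thesis by (simp add: scaleR_diff_right scaleR_diff_left)
        qed
        also have "norm \<dots> \<le> s * norm (p - q) + \<bar>s - r\<bar> * norm q"
          using norm_triangle_ineq[of "s *\<^sub>R (p - q)" "(s - r) *\<^sub>R q"] s by simp
        also have "\<dots> \<le> 1 * norm (p - q) + \<tau> / 2 * 1"
          using s sr pq by (intro add_mono mult_right_mono) auto
        also have "\<dots> \<le> \<epsilon>" using \<open>norm (p - q) < \<epsilon> / 2\<close> \<tau> by (simp add: \<tau>_def)
        finally show ?thesis using \<beta> by blast
      qed
    qed
    moreover have "clin h" unfolding clin_iff h_def by (auto simp: f_add f_scale scaleC_complex_def algebra_simps)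
    moreover have "cmod (h z) \<le> 3 * norm z" for z
      unfolding h_def norm_mult using b0 b3 f(2) by (intro mult_mono) auto
    moreover have "0 \<le> a" "a \<le> 1" using br b0 r0 by (auto simp: a_def)
    moreover have "of_real a + h x0 = 1" by (simp add: a_def h_def f(3))
    ultimately show "\<exists>a h. peaks_at N \<epsilon> \<omega> x0 a h"
      unfolding peaks_at_def r_def by (intro exI[of _ a] exI[of _ h]) auto
  qed
qed

subsection \<open>Iterated perturbation\<close>

context
  fixes P :: "'a::complex_normed_vector \<Rightarrow> 'b::complex_normed_vector" and N :: nat
  assumes P: "P \<in> polys_upto N"
begin

lemma polys_upto_weighted_bdd: "bdd_above ((\<lambda>z. (1 - (norm z)\<^sup>2) * norm (P z)) ` ball 0 1)"
proof -
  obtain M where M: "\<And>z. norm z \<le> 1 \<Longrightarrow> norm (P z) \<le> M"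
    using polys_upto_bounded[OF P] by blast
  show ?thesis
  proof (rule bdd_aboveI2)
    fix z :: 'a assume "z \<in> ball 0 1"
    then have "norm z \<le> 1" by simp
    moreover have "(1 - (norm z)\<^sup>2) * norm (P z) \<le> 1 * norm (P z)" by (intro mult_right_mono) auto
    ultimately show "(1 - (norm z)\<^sup>2) * norm (P z) \<le> M" using M[of z] by simp
  qed
qed

lemma norm_v_upper: "norm z < 1 \<Longrightarrow> (1 - (norm z)\<^sup>2) * norm (P z) \<le> norm_v P"
  unfolding norm_v_def by (rule cSUP_upper[OF _ polys_upto_weighted_bdd]) simp

lemma norm_v_approx:
  assumes "e > 0"
  obtains z where "norm z < 1" "norm_v P - e \<le> (1 - (norm z)\<^sup>2) * norm (P z)"
proof -
  have "norm_v P - e < norm_v P" using assms by simp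
  then obtain z where "z \<in> ball 0 1" "norm_v P - e < (1 - (norm z)\<^sup>2) * norm (P z)"
    using less_cSUP_iff[OF _ polys_upto_weighted_bdd, of "norm_v P - e", folded norm_v_def] by auto
  then show ?thesis by (intro that[of z]) auto
qed

end

definition power_term :: "nat \<Rightarrow> real \<Rightarrow> real \<Rightarrow> ('a \<Rightarrow> complex) \<Rightarrow> 'b::complex_normed_vector \<Rightarrow> 'a \<Rightarrow> 'b"
  where "power_term N c a h u z = (of_real c * (of_real a + h z) ^ N) *\<^sub>C u"

lemma norm_less_one:
  assumes "(real N + 2) * (norm y)\<^sup>2 \<le> real N"
  shows "norm y < 1"
proof -
  have "\<not> 1 \<le> (norm y)\<^sup>2"
  proof
    assume "1 \<le> (norm y)\<^sup>2"
    then have "(real N + 2) * 1 \<le> (real N + 2) * (norm y)\<^sup>2" by (intro mult_left_mono) auto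
    from order_trans[OF this assms] show False by simp
  qed
  then show ?thesis by (intro power2_less_imp_less[of "norm y" 1]) auto
qed

text \<open>As u points along \<open>P x\<close>, the new term adds exactly c to the norm at x, so
  the supremum grows by at least \<open>c * (1 - (norm x)\<^sup>2) - \<eta>\<close>. At an almost
  maximal y of the new polynomial the gain is at most c times the weighted modulus of the peak
  polynomial. That modulus is therefore within \<open>(\<eta> + \<eta>') / c \<le> \<omega>\<close>
  of its value at x, and y is close to a rotation of x.\<close>

lemma perturb_step:
  fixes P :: "'a::complex_normed_vector \<Rightarrow> 'b::complex_banach"
  assumes P: "P \<in> polys_upto N" and x: "norm x < 1" "norm_v P - \<eta> \<le> (1 - (norm x)\<^sup>2) * norm (P x)"
    and peak: "peaks_at N \<epsilon> \<omega> x a h" and c: "c > 0" and \<eta>: "\<eta>' > 0" "\<eta> + \<eta>' \<le> c * \<omega>"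
    and e: "(e::'b) \<noteq> 0"
  shows "\<exists>u y \<beta>. norm u = 1 \<and> (\<lambda>z. P z + power_term N c a h u z) \<in> polys_upto N \<and>
    (real N + 2) * (norm y)\<^sup>2 \<le> real N \<and> cmod \<beta> = 1 \<and> norm (y - \<beta> *\<^sub>C x) \<le> \<epsilon> \<and>
    norm_v (\<lambda>z. P z + power_term N c a h u z) - \<eta>'
      \<le> (1 - (norm y)\<^sup>2) * norm (P y + power_term N c a h u y)"
proof -
  have h: "0 \<le> a" "a \<le> 1" "clin h" "\<And>z. cmod (h z) \<le> 3 * norm z" "of_real a + h x = 1"
    and near: "\<And>z. norm z < 1 \<Longrightarrow> (1 - (norm x)\<^sup>2) - \<omega> \<le> (1 - (norm z)\<^sup>2) * cmod (of_real a + h z) ^ N \<Longrightarrow>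
      \<exists>\<beta>. cmod \<beta> = 1 \<and> norm (z - \<beta> *\<^sub>C x) \<le> \<epsilon>"
    using peak unfolding peaks_at_def by auto
  \<comment> \<open>If \<open>P x = 0\<close>, any unit vector serves; \<open>e\<close> guarantees
    that one exists.\<close>
  define u where "u = (if P x = 0 then sgn e else sgn (P x))"
  have u: "norm u = 1" using e by (simp add: u_def norm_sgn)
  define P' where "P' z = P z + power_term N c a h u z" for z
  have P': "P' \<in> polys_upto N"
    unfolding P'_def[abs_def] power_term_def
    by (intro polys_upto_add P polys_upto_power[where K = 3]) (use c h u in auto)
  have "P' x = P x + c *\<^sub>R u" by (simp add: P'_def power_term_def h(5) scaleC_of_real)
  also have "norm \<dots> = norm (P x) + c"
  proof (cases "P x = 0")
    case False
    then have "P x + c *\<^sub>R u = (1 + c / norm (P x)) *\<^sub>R P x"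
      by (simp add: u_def sgn_div_norm scaleR_add_left divide_inverse)
    then have "norm (P x + c *\<^sub>R u) = (1 + c / norm (P x)) * norm (P x)" using c by simp
    also have "\<dots> = norm (P x) + c" using False by (simp add: distrib_right)
    finally show ?thesis .
  qed (use c u in auto)
  finally have P'x: "norm (P' x) = norm (P x) + c" .
  obtain y0 where y0: "norm y0 < 1" "norm_v P' - \<eta>' \<le> (1 - (norm y0)\<^sup>2) * norm (P' y0)"
    using norm_v_approx[OF P' \<eta>(1)] by blast
  \<comment> \<open>The inward move makes a peak polynomial available at the new point.\<close>
  obtain d where d: "(real N + 2) * (norm (d *\<^sub>C y0))\<^sup>2 \<le> real N"
    "(1 - (norm y0)\<^sup>2) * norm (P' y0) \<le> (1 - (norm (d *\<^sub>C y0))\<^sup>2) * norm (P' (d *\<^sub>C y0))"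
    using polys_upto_move_inwards[OF P' y0(1)] by blast
  define y where "y = d *\<^sub>C y0"
  have yN: "(real N + 2) * (norm y)\<^sup>2 \<le> real N" using d by (simp add: y_def)
  have y1: "norm y < 1" using yN by (rule norm_less_one)
  have yP': "norm_v P' - \<eta>' \<le> (1 - (norm y)\<^sup>2) * norm (P' y)" using y0 d by (simp add: y_def)
  define w where "w = 1 - (norm y)\<^sup>2"
  have w: "w > 0" using y1 by (simp add: w_def power_less_one_iff)
  have "norm (power_term N c a h u y) = c * cmod (of_real a + h y) ^ N"
    using c u by (simp add: power_term_def norm_scaleC norm_mult norm_power)
  then have "norm (P' y) \<le> norm (P y) + c * cmod (of_real a + h y) ^ N"
    unfolding P'_def by (metis norm_triangle_ineq)
  then have "w * norm (P' y) \<le> w * norm (P y) + c * (w * cmod (of_real a + h y) ^ N)"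
    using mult_left_mono[of _ _ w] w by (fastforce simp: algebra_simps)
  moreover have "w * norm (P y) \<le> norm_v P" unfolding w_def by (rule norm_v_upper[OF P y1])
  moreover have "(1 - (norm x)\<^sup>2) * norm (P' x) \<le> norm_v P'" by (rule norm_v_upper[OF P' x(1)])
  moreover have "norm_v P' - \<eta>' \<le> w * norm (P' y)" using yP' by (simp add: w_def)
  ultimately have "c * (1 - (norm x)\<^sup>2) - (\<eta> + \<eta>') \<le> c * (w * cmod (of_real a + h y) ^ N)"
    using x(2) unfolding P'x by (simp add: algebra_simps)
  then have "c * ((1 - (norm x)\<^sup>2) - \<omega>) \<le> c * (w * cmod (of_real a + h y) ^ N)"
    using \<eta>(2) unfolding right_diff_distrib by linarith
  then have "(1 - (norm x)\<^sup>2) - \<omega> \<le> w * cmod (of_real a + h y) ^ N"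
    using c by (simp only: mult_le_cancel_left_pos)
  then obtain \<beta> where "cmod \<beta> = 1" "norm (y - \<beta> *\<^sub>C x) \<le> \<epsilon>"
    using near[OF y1] unfolding w_def by blast
  then show ?thesis using u P' yN yP' unfolding P'_def[abs_def]
    by (intro exI[of _ u] exI[of _ y] exI[of _ \<beta>] conjI)
qed

section \<open>Construction of the limit polynomial and of its maximal point\<close>

theorem theorem3p4:
  fixes N :: nat and \<epsilon> :: real
  assumes "uniformly_convex TYPE('a::complex_banach)"
    and "\<epsilon> > 0"
  shows "\<exists>\<eta>>0. \<forall>P \<in> (polys_upto N :: ('a \<Rightarrow> 'b::complex_banach) set). \<forall>x \<in> ball 0 1.
           norm_v P = 1 \<and> (1 - (norm x)\<^sup>2) * norm (P x) \<ge> norm_v P - \<eta> \<longrightarrow>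
           (\<exists>Q \<in> polys_upto N. \<exists>y \<in> ball 0 1.
              norm_v Q = (1 - (norm y)\<^sup>2) * norm (Q y) \<and>
              infdist y (range (\<lambda>c. c *\<^sub>C x)) \<le> \<epsilon> \<and>
              norm_inf (\<lambda>z. P z - Q z) \<le> \<epsilon>)"
proof -
  \<comment> \<open>The \<open>E n\<close> add up to \<open>\<epsilon>\<close> and will bound both
    the displacement of the points and the perturbation. Division by \<open>4 ^ N\<close>
    compensates the size of the peak polynomials, since \<open>a + h\<close> has modulus at most 1 +
    3 on the unit ball.\<close>
  define E where "E n = \<epsilon> * (1 / 2) ^ Suc n" for n
  define C where "C n = E n / 4 ^ N" for n
  have E: "E n > 0" for n using assms(2) by (simp add: E_def)
  have E_sums: "E sums \<epsilon>"
    unfolding E_def using sums_mult[OF power_half_series, of \<epsilon>] by simp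
  have C: "C n > 0" for n using E by (simp add: C_def)
  have C_summable: "summable C"
    unfolding C_def by (intro summable_divide sums_summable[OF E_sums])
  have "\<forall>n. \<exists>\<omega>>0. \<forall>x::'a. (real N + 2) * (norm x)\<^sup>2 \<le> real N \<longrightarrow> (\<exists>a h. peaks_at N (E n) \<omega> x a h)"
    using peak_polynomial_exists[OF assms(1) E] by blast
  then obtain \<omega> where \<omega>: "\<And>n. \<omega> n > 0"
    and peak: "\<And>n x::'a. (real N + 2) * (norm x)\<^sup>2 \<le> real N \<Longrightarrow> \<exists>a h. peaks_at N (E n) (\<omega> n) x a h"
    by metis
  \<comment> \<open>Half of \<open>C n * \<omega> n\<close> leaves room for the two consecutive
    errors in \<open>perturb_step\<close>; the minimum over the prefix makes
    \<open>\<eta> (Suc n)\<close> obey the bound of index n as well. The powers of 1/2 drive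
    \<open>\<eta>\<close> to 0.\<close>
  define \<kappa> where "\<kappa> n = min (C n * \<omega> n / 2) ((1 / 2) ^ n)" for n
  define \<eta> where "\<eta> n = Min (\<kappa> ` {..n})" for n
  have \<kappa>: "\<kappa> n > 0" for n using C \<omega> by (simp add: \<kappa>_def)
  have \<eta>_pos: "\<eta> n > 0" for n using \<kappa> by (simp add: \<eta>_def)
  have \<eta>_le: "\<eta> n \<le> \<kappa> m" if "m \<le> n" for m n unfolding \<eta>_def using that by (intro Min_le) auto
  have \<eta>_step: "\<eta> n + \<eta> (Suc n) \<le> C n * \<omega> n" for n
    using \<eta>_le[of n n] \<eta>_le[of n "Suc n"] by (simp add: \<kappa>_def)
  have \<eta>_lim: "\<eta> \<longlonglongrightarrow> 0"
  proof (rule tendsto_sandwich[of "\<lambda>_. 0" _ _ "\<lambda>n. (1 / 2) ^ n"])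
    show "\<forall>\<^sub>F n in sequentially. \<eta> n \<le> (1 / 2) ^ n"
      using \<eta>_le[of n n for n] by (intro always_eventually) (auto simp: \<kappa>_def)
  qed (use \<eta>_pos in \<open>auto intro!: LIMSEQ_power_zero always_eventually less_imp_le\<close>)
  show ?thesis
  proof (intro exI[of _ "\<eta> 0"] conjI ballI impI \<eta>_pos)
    fix P :: "'a \<Rightarrow> 'b" and x :: 'a
    assume P: "P \<in> polys_upto N" and "x \<in> ball 0 1"
      and *: "norm_v P = 1 \<and> norm_v P - \<eta> 0 \<le> (1 - (norm x)\<^sup>2) * norm (P x)"
    then have x: "norm x < 1" by simp
    \<comment> \<open>A nonzero vector for \<open>perturb_step\<close>; it exists because
      \<open>norm_v P = 1\<close>.\<close>
    obtain e :: 'b where e: "e \<noteq> 0"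
    proof -
      have "\<exists>z. P z \<noteq> 0"
      proof (rule ccontr)
        assume "\<nexists>z. P z \<noteq> 0"
        then have "norm_v P = 0" by (simp add: norm_v_def)
        with * show False by simp
      qed
      then show ?thesis using that by blast
    qed
    obtain d where d: "(real N + 2) * (norm (d *\<^sub>C x))\<^sup>2 \<le> real N"
      "(1 - (norm x)\<^sup>2) * norm (P x) \<le> (1 - (norm (d *\<^sub>C x))\<^sup>2) * norm (P (d *\<^sub>C x))"
      using polys_upto_move_inwards[OF P x] by blast
    \<comment> \<open>A state holds a polynomial R with the almost maximal point
      \<open>\<beta> *\<^sub>C v\<close>. The phase is stored apart: the points may jump around
      their circles, but \<open>v\<close> moves by at most \<open>E n\<close>.\<close>
    define good where "good n = (\<lambda>(R :: 'a \<Rightarrow> 'b, v :: 'a, \<beta>). R \<in> polys_upto N \<and> cmod \<beta> = 1 \<and> (real N + 2) * (norm v)\<^sup>2 \<le> real N \<and>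
        norm_v R - \<eta> n \<le> (1 - (norm v)\<^sup>2) * norm (R (\<beta> *\<^sub>C v)) \<and>
        (n = 0 \<longrightarrow> R = P \<and> v = d *\<^sub>C x))"
      for n :: nat
    \<comment> \<open>Of the peak property only the bounds are remembered, which suffice for summing
      the perturbations.\<close>
    define succ where "succ n = (\<lambda>(R :: 'a \<Rightarrow> 'b, v :: 'a, \<beta> :: complex) (R' :: 'a \<Rightarrow> 'b, v' :: 'a, \<beta>' :: complex). norm (v' - v) \<le> E n \<and>
        (\<exists>a h u. 0 \<le> a \<and> a \<le> 1 \<and> clin h \<and> (\<forall>z. cmod (h z) \<le> 3 * norm z) \<and> norm u \<le> 1 \<and>
          R' = (\<lambda>z. R z + power_term N (C n) a h u z)))"
      for n
    have "\<exists>f. \<forall>n. good n (f n) \<and> succ n (f n) (f (Suc n))"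
    proof (rule dependent_nat_choice)
      show "\<exists>s. good 0 s"
        using P * d by (intro exI[of _ "(P, d *\<^sub>C x, 1)"]) (auto simp: good_def)
      fix s n assume s: "good n s"
      obtain R v \<beta> where s_eq: "s = (R, v, \<beta>)" by (metis prod_cases3)
      have R: "R \<in> polys_upto N" and \<beta>: "cmod \<beta> = 1" and v: "(real N + 2) * (norm v)\<^sup>2 \<le> real N"
        and Rv: "norm_v R - \<eta> n \<le> (1 - (norm v)\<^sup>2) * norm (R (\<beta> *\<^sub>C v))"
        using s by (auto simp: s_eq good_def)
      define x0 where "x0 = \<beta> *\<^sub>C v"
      have nx0: "norm x0 = norm v" using \<beta> by (simp add: x0_def norm_scaleC)
      obtain a h where peak: "peaks_at N (E n) (\<omega> n) x0 a h" using peak[of x0 n] v nx0 by auto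
      have "norm_v R - \<eta> n \<le> (1 - (norm x0)\<^sup>2) * norm (R x0)" using Rv by (simp add: nx0 flip: x0_def)
      moreover have "norm x0 < 1" using v norm_less_one unfolding nx0 by blast
      ultimately obtain u y \<beta>' where u: "norm u = 1" and R': "(\<lambda>z. R z + power_term N (C n) a h u z) \<in> polys_upto N"
        and y: "(real N + 2) * (norm y)\<^sup>2 \<le> real N" and \<beta>': "cmod \<beta>' = 1" "norm (y - \<beta>' *\<^sub>C x0) \<le> E n"
        and R'y: "norm_v (\<lambda>z. R z + power_term N (C n) a h u z) - \<eta> (Suc n)
          \<le> (1 - (norm y)\<^sup>2) * norm (R y + power_term N (C n) a h u y)"
        using perturb_step[OF R _ _ peak C \<eta>_pos \<eta>_step e] by blast
      \<comment> \<open>The phases accumulate: y is near \<open>\<gamma> *\<^sub>C v\<close>, so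
        \<open>cnj \<gamma> *\<^sub>C y\<close> is near v and becomes the next base point.\<close>
      define \<gamma> where "\<gamma> = \<beta>' * \<beta>"
      have \<gamma>: "cmod \<gamma> = 1" using \<beta> \<beta>' by (simp add: \<gamma>_def norm_mult)
      have "\<gamma> * cnj \<gamma> = 1" using complex_norm_square[of \<gamma>] \<gamma> by simp
      then have \<gamma>y: "\<gamma> *\<^sub>C cnj \<gamma> *\<^sub>C y = y" and \<gamma>v: "cnj \<gamma> *\<^sub>C \<gamma> *\<^sub>C v = v" by (simp_all add: scaleC_scaleC mult.commute)
      have "cnj \<gamma> *\<^sub>C y - v = cnj \<gamma> *\<^sub>C (y - \<gamma> *\<^sub>C v)" by (simp only: scaleC_diff_right \<gamma>v)
      then have "norm (cnj \<gamma> *\<^sub>C y - v) = norm (y - \<gamma> *\<^sub>C v)" using \<gamma> by (simp add: norm_scaleC)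
      also have "\<dots> \<le> E n" using \<beta>'(2) by (simp add: \<gamma>_def x0_def scaleC_scaleC)
      finally have "norm (cnj \<gamma> *\<^sub>C y - v) \<le> E n" .
      then have "succ n s (\<lambda>z. R z + power_term N (C n) a h u z, cnj \<gamma> *\<^sub>C y, \<gamma>)"
        using u peak unfolding succ_def s_eq prod.case peaks_at_def
        by (intro conjI exI[of _ a] exI[of _ h] exI[of _ u]) auto
      moreover have "good (Suc n) (\<lambda>z. R z + power_term N (C n) a h u z, cnj \<gamma> *\<^sub>C y, \<gamma>)"
        using R' \<gamma> y R'y \<gamma>y by (simp add: good_def norm_scaleC)
      ultimately show "\<exists>s'. good (Suc n) s' \<and> succ n s s'" by blast
    qed
    then obtain f where f: "\<And>n. good n (f n)" "\<And>n. succ n (f n) (f (Suc n))" by blast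
    define R where "R n = fst (f n)" for n
    define v where "v n = fst (snd (f n))" for n
    define \<beta> where "\<beta> n = snd (snd (f n))" for n
    have f_eq: "f n = (R n, v n, \<beta> n)" for n by (simp add: R_def v_def \<beta>_def)
    have R: "R n \<in> polys_upto N" and \<beta>: "cmod (\<beta> n) = 1" and v: "(real N + 2) * (norm (v n))\<^sup>2 \<le> real N"
      and Rv: "norm_v (R n) - \<eta> n \<le> (1 - (norm (v n))\<^sup>2) * norm (R n (\<beta> n *\<^sub>C v n))" for n
      using f(1)[of n] by (auto simp: f_eq good_def)
    have R0: "R 0 = P" and v0: "v 0 = d *\<^sub>C x" using f(1)[of 0] by (auto simp: f_eq good_def)
    have v_step: "norm (v (Suc n) - v n) \<le> E n" for n using f(2)[of n] by (auto simp: f_eq succ_def)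
    have "\<forall>n. \<exists>a h u. 0 \<le> a \<and> a \<le> 1 \<and> clin h \<and> (\<forall>z. cmod (h z) \<le> 3 * norm z) \<and> norm u \<le> 1 \<and>
        R (Suc n) = (\<lambda>z. R n z + power_term N (C n) a h u z)"
      using f(2) by (auto simp: f_eq succ_def)
    then obtain a h u where ahu: "\<And>n. 0 \<le> a n \<and> a n \<le> 1 \<and> clin (h n) \<and> (\<forall>z. cmod (h n z) \<le> 3 * norm z) \<and>
        norm (u n) \<le> 1 \<and> R (Suc n) = (\<lambda>z. R n z + power_term N (C n) (a n) (h n) (u n) z)"
      unfolding choice_iff by blast
    have a: "0 \<le> a n" "a n \<le> 1" and h: "clin (h n)" "cmod (h n z) \<le> 3 * norm z" and u: "norm (u n) \<le> 1"
      and R_Suc: "R (Suc n) = (\<lambda>z. R n z + power_term N (C n) (a n) (h n) (u n) z)" for n z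
      using ahu[of n] by auto
    define T where "T n z = power_term N (C n) (a n) (h n) (u n) z" for n z
    have T_bound: "norm (T n z) \<le> E n" if "norm z \<le> 1" for n z
    proof -
      have "cmod (of_real (a n) + h n z) \<le> a n + 3 * norm z"
        using norm_triangle_ineq[of "of_real (a n)" "h n z"] h(2)[of n z] a(1)[of n] by simp
      also have "\<dots> \<le> 4" using a(2)[of n] that by simp
      finally have "cmod (of_real (a n) + h n z) ^ N \<le> 4 ^ N" by (rule power_mono) simp
      then have "C n * cmod (of_real (a n) + h n z) ^ N * norm (u n) \<le> C n * 4 ^ N * 1"
        using C[of n] u by (intro mult_mono) auto
      moreover have "norm (T n z) = C n * cmod (of_real (a n) + h n z) ^ N * norm (u n)"
        using C[of n] by (simp add: T_def power_term_def norm_scaleC norm_mult norm_power)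
      ultimately show ?thesis by (simp add: C_def)
    qed
    define Q where "Q z = P z + (\<Sum>n. T n z)" for z
    have Q: "Q \<in> polys_upto N"
      unfolding Q_def[abs_def] T_def power_term_def
      by (intro polys_upto_add P polys_upto_power_series[where K = 3] C_summable)
        (use C a h u in \<open>auto intro: less_imp_le\<close>)

    have R_eq: "R n z = P z + (\<Sum>i<n. T i z)" for n z
      by (induction n) (simp_all add: R0 R_Suc T_def)
    have "uniform_limit (cball 0 1) (\<lambda>n z. \<Sum>i<n. T i z) (\<lambda>z. \<Sum>i. T i z) sequentially"
      by (rule Weierstrass_m_test[OF _ sums_summable[OF E_sums]]) (simp add: T_bound)
    then have R_unif: "uniform_limit (cball 0 1) R Q sequentially"
      unfolding R_eq[abs_def] Q_def[abs_def] by (intro uniform_limit_intros)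
    have PQ: "norm_inf (\<lambda>z. P z - Q z) \<le> \<epsilon>"
      unfolding norm_inf_def
    proof (rule cSUP_least)
      fix z :: 'a assume "z \<in> ball 0 1"
      then have z: "norm z \<le> 1" by simp
      have "norm (\<Sum>n. T n z) \<le> (\<Sum>n. E n)"
        by (rule norm_suminf_le[OF T_bound[OF z] sums_summable[OF E_sums]])
      then show "norm (P z - Q z) \<le> \<epsilon>" by (simp add: Q_def sums_unique[OF E_sums, symmetric])
    qed simp
    have v_summable: "summable (\<lambda>n. norm (v (Suc n) - v n))"
      by (rule summable_comparison_test'[OF sums_summable[OF E_sums]]) (simp add: v_step)
    define l where "l = v 0 + (\<Sum>n. v (Suc n) - v n)"
    have v_lim: "v \<longlonglongrightarrow> l"
    proof -
      have "(\<lambda>n. v 0 + (\<Sum>i<n. v (Suc i) - v i)) \<longlonglongrightarrow> l"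
        unfolding l_def by (intro tendsto_intros summable_LIMSEQ summable_norm_cancel[OF v_summable])
      then show ?thesis by (simp add: sum_lessThan_telescope)
    qed
    have "norm (l - v 0) \<le> (\<Sum>n. E n)"
      unfolding l_def using norm_suminf_le[OF v_step sums_summable[OF E_sums]] by simp
    then have l_dist: "norm (l - d *\<^sub>C x) \<le> \<epsilon>" by (simp add: v0 sums_unique[OF E_sums, symmetric])
    \<comment> \<open>The phases need not converge; compactness of the unit circle supplies a
      subsequence.\<close>
    have "seq_compact (sphere (0::complex) 1)" by (intro compact_imp_seq_compact) simp
    then obtain b r where b: "cmod b = 1" and r: "strict_mono r" "(\<beta> \<circ> r) \<longlonglongrightarrow> b"
      by (rule seq_compactE[where f = \<beta>]) (use \<beta> in auto)
    define y where "y = b *\<^sub>C l"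
    define w where "w n = \<beta> (r n) *\<^sub>C v (r n)" for n
    have w_lim: "w \<longlonglongrightarrow> y"
      unfolding w_def y_def
      using r(2) LIMSEQ_subseq_LIMSEQ[OF v_lim r(1)]
      by (intro bounded_bilinear.tendsto[OF bounded_bilinear_scaleC]) (simp_all add: comp_def)
    have nw: "norm (w n) = norm (v (r n))" for n using \<beta> by (simp add: w_def norm_scaleC)
    have w1: "norm (w n) \<le> 1" for n using norm_less_one[OF v[of "r n"]] by (simp add: nw)
    \<comment> \<open>The radius bound is a closed condition, which keeps the limit point inside the
      open ball.\<close>
    have "(real N + 2) * (norm y)\<^sup>2 \<le> real N"
    proof (rule LIMSEQ_le_const2)
      show "(\<lambda>n. (real N + 2) * (norm (w n))\<^sup>2) \<longlonglongrightarrow> (real N + 2) * (norm y)\<^sup>2"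
        using w_lim by (intro tendsto_intros)
    qed (use v in \<open>simp add: nw\<close>)
    then have y1: "norm y < 1" by (rule norm_less_one)
    have Rw_lim: "(\<lambda>n. R (r n) (w n)) \<longlonglongrightarrow> Q y"
    proof -
      \<comment> \<open>The evaluation points move as well: uniform convergence handles the
        polynomials, continuity of \<open>Q\<close> the points.\<close>
      have "(\<lambda>n. R (r n) (w n) - Q (w n)) \<longlonglongrightarrow> 0"
      proof (rule tendstoI)
        fix e :: real assume "e > 0"
        then have "\<forall>\<^sub>F n in sequentially. \<forall>z\<in>cball 0 1. dist (R n z) (Q z) < e"
          using R_unif by (simp add: uniform_limit_iff)
        then have "\<forall>\<^sub>F n in sequentially. \<forall>z\<in>cball 0 1. dist (R (r n) z) (Q z) < e"
          by (rule eventually_subseq[OF r(1)])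
        then show "\<forall>\<^sub>F n in sequentially. dist (R (r n) (w n) - Q (w n)) 0 < e"
          by eventually_elim (use w1 in \<open>auto simp: dist_norm\<close>)
      qed
      moreover have "(\<lambda>n. Q (w n)) \<longlonglongrightarrow> Q y"
        using polys_upto_continuous[OF Q] w_lim by (auto intro: continuous_on_tendsto_compose)
      ultimately have "(\<lambda>n. (R (r n) (w n) - Q (w n)) + Q (w n)) \<longlonglongrightarrow> 0 + Q y" by (rule tendsto_add)
      then show ?thesis by simp
    qed
    \<comment> \<open>The limit of the almost maximality of \<open>w n\<close> for
      \<open>R (r n)\<close>, whose error \<open>\<eta> (r n)\<close> tends to 0.\<close>
    have Q_max: "(1 - (norm z)\<^sup>2) * norm (Q z) \<le> (1 - (norm y)\<^sup>2) * norm (Q y)" if z: "norm z < 1" for z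
    proof (rule LIMSEQ_le)
      have "(\<lambda>n. R n z) \<longlonglongrightarrow> Q z" using tendsto_uniform_limitI[OF R_unif, of z] z by simp
      then have "(\<lambda>n. R (r n) z) \<longlonglongrightarrow> Q z" using LIMSEQ_subseq_LIMSEQ[OF _ r(1)] by (force simp: comp_def)
      then show "(\<lambda>n. (1 - (norm z)\<^sup>2) * norm (R (r n) z)) \<longlonglongrightarrow> (1 - (norm z)\<^sup>2) * norm (Q z)"
        by (intro tendsto_intros)
      have "(\<lambda>n. \<eta> (r n)) \<longlonglongrightarrow> 0" using LIMSEQ_subseq_LIMSEQ[OF \<eta>_lim r(1)] by (simp add: comp_def)
      then have "(\<lambda>n. (1 - (norm (w n))\<^sup>2) * norm (R (r n) (w n)) + \<eta> (r n)) \<longlonglongrightarrow> (1 - (norm y)\<^sup>2) * norm (Q y) + 0"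
        using w_lim Rw_lim by (intro tendsto_intros)
      then show "(\<lambda>n. (1 - (norm (w n))\<^sup>2) * norm (R (r n) (w n)) + \<eta> (r n)) \<longlonglongrightarrow> (1 - (norm y)\<^sup>2) * norm (Q y)"
        by simp
      have "(1 - (norm z)\<^sup>2) * norm (R (r n) z) \<le> (1 - (norm (w n))\<^sup>2) * norm (R (r n) (w n)) + \<eta> (r n)" for n
        using norm_v_upper[OF R z, of "r n"] Rv[of "r n"] by (simp add: nw) (simp add: w_def)
      then show "\<exists>n0. \<forall>n\<ge>n0. (1 - (norm z)\<^sup>2) * norm (R (r n) z) \<le> (1 - (norm (w n))\<^sup>2) * norm (R (r n) (w n)) + \<eta> (r n)"
        by blast
    qed
    have Q_norm: "norm_v Q = (1 - (norm y)\<^sup>2) * norm (Q y)"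
    proof (rule antisym)
      show "norm_v Q \<le> (1 - (norm y)\<^sup>2) * norm (Q y)"
        unfolding norm_v_def by (rule cSUP_least) (auto intro: Q_max)
    qed (rule norm_v_upper[OF Q y1])
    \<comment> \<open>The initial base point \<open>d *\<^sub>C x\<close> lies in the span of x, and
      so does its rotation by b, whose distance from y is
      \<open>norm (l - d *\<^sub>C x)\<close>.\<close>
    have "infdist y (range (\<lambda>c. c *\<^sub>C x)) \<le> dist y ((b * d) *\<^sub>C x)" by (intro infdist_le) blast
    also have "\<dots> = norm (b *\<^sub>C (l - d *\<^sub>C x))" by (simp add: dist_norm y_def scaleC_diff_right scaleC_scaleC)
    also have "\<dots> \<le> \<epsilon>" using l_dist b by (simp add: norm_scaleC)
    finally have y_dist: "infdist y (range (\<lambda>c. c *\<^sub>C x)) \<le> \<epsilon>" .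
    show "\<exists>Q\<in>polys_upto N. \<exists>y\<in>ball 0 1. norm_v Q = (1 - (norm y)\<^sup>2) * norm (Q y) \<and>
            infdist y (range (\<lambda>c. c *\<^sub>C x)) \<le> \<epsilon> \<and> norm_inf (\<lambda>z. P z - Q z) \<le> \<epsilon>"
      using Q y1 Q_norm y_dist PQ by (intro bexI[of _ Q] bexI[of _ y]) auto
  qed
qed

end
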